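(* Assume Assumptions (LS), (UT), (LT) and (LB) below hold, with $\alpha>0$ the common exponent in (UT) and (LT). Then there exist constants $c>0$, $\eta>0$, $\theta_0$ and $r_0$ (depending on $\alpha$) such that for all $r>r_0$ and $\theta_0<\theta<\eta r^{2/3}$, $$\mathbb{P}\left(X_r-\mathbb{E}[X_r]\le-\theta r^{1/3}\right)\ge\exp\left(-c\theta^3\right).$$
   Context: Let $\{\xi_v:v\in\mathbb{Z}^2\}$ be i.i.d. random variables with a common law $\nu$ supported on $[0,\infty)$. A directed path is an up-right nearest-neighbour path in $\mathbb{Z}^2$, and its weight is $\ell(\gamma)=\sum_{u\in\gamma}\xi_u$. For $u\preceq v$ coordinatewise, $X_{u,v}=\max_{\gamma:u\to v}\ell(\gamma)$ over directed paths from $u$ to $v$ ($-\infty$ if none). For $r\in\mathbb{N}$, $z\in\mathbb{Z}$, $X_r^z=X_{(1,1),(r-z,r+z)}$ and $X_r=X_r^0$. It is assumed that $\mu=\lim_{r\to\infty}r^{-1}\mathbb{E}[X_r]<\infty$. Assumption (LS): there exist positive finite constants $\rho,G,H,g_1,g_2$ such that for all large enough $r$ and all $z\in[-\rho r,\rho r]$, $\mathbb{E}[X_r^z]\in \mu r-G\frac{z^2}{r}+\left[-H\frac{z^4}{r^3},0\right]+\left[-g_1r^{1/3},-g_2r^{1/3}\right]$. Assumptions (UT) and (LT): there exists $\alpha>0$ such that for every $\varepsilon>0$ there exist positive finite $c,\theta_0,r_0$ (depending only on $\varepsilon$) such that for all $r>r_0$, $\theta>\theta_0$ and $|z|\le(1-\varepsilon)r$: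 (UT) $\mathbb{P}(X_r^z-\mathbb{E}[X_r^z]>\theta r^{1/3})\le\exp(-c\theta^\alpha)$ and (LT) $\mathbb{P}(X_r^z-\mathbb{E}[X_r^z]<-\theta r^{1/3})\le\exp(-c\theta^\alpha)$. Assumption (LB): there exist constants $\delta>0$, $C>0$, $r_0$ such that for all $r>r_0$, $\mathbb{P}(X_r-\mu r<-Cr^{1/3})\ge\delta$. *)

theory Defs
  imports "HOL-Probability.Probability"
begin

definition up_right :: "(int \<times> int) list \<Rightarrow> bool" where
  "up_right \<gamma> \<longleftrightarrow> (\<forall>i. Suc i < length \<gamma> \<longrightarrow>
      (\<gamma> ! Suc i = (fst (\<gamma> ! i) + 1, snd (\<gamma> ! i)) \<or>
       \<gamma> ! Suc i = (fst (\<gamma> ! i), snd (\<gamma> ! i) + 1)))"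

definition dpaths :: "int \<times> int \<Rightarrow> int \<times> int \<Rightarrow> (int \<times> int) list set" where
  "dpaths u v = {\<gamma>. \<gamma> \<noteq> [] \<and> hd \<gamma> = u \<and> last \<gamma> = v \<and> up_right \<gamma>}"

definition path_weight :: "(int \<times> int \<Rightarrow> real) \<Rightarrow> (int \<times> int) list \<Rightarrow> real" where
  "path_weight w \<gamma> = sum_list (map w \<gamma>)"

text \<open>Last passage value X_{u,v} (only meaningful when a directed path u \<rightarrow> v exists).\<close>
definition lpp :: "(int \<times> int \<Rightarrow> real) \<Rightarrow> int \<times> int \<Rightarrow> int \<times> int \<Rightarrow> real" where
  "lpp w u v = Max (path_weight w ` dpaths u v)"

definition Xrz :: "(int \<times> int \<Rightarrow> 'a \<Rightarrow> real) \<Rightarrow> nat \<Rightarrow> int \<Rightarrow> 'a \<Rightarrow> real" where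
  "Xrz \<xi> r z \<omega> = lpp (\<lambda>v. \<xi> v \<omega>) (1, 1) (int r - z, int r + z)"

end

theory Submission
  imports Defs "HOL-Real_Asymp.Real_Asymp"
begin

text \<open>Cut the square into \<open>k \<approx> \<theta>\<^sup>3\<^sup>/\<^sup>2\<close> slabs orthogonal to the diagonal, of height of order
  \<open>r / k\<close>, and each slab into columns of width of order \<open>(r / k)\<^sup>2\<^sup>/\<^sup>3\<close>. If every crossing of every
  slab falls short of its typical value by a constant times \<open>(r / k)\<^sup>1\<^sup>/\<^sup>3\<close>, then the total deficit is of
  order \<open>k (r / k)\<^sup>1\<^sup>/\<^sup>3 \<approx> \<theta> r\<^sup>1\<^sup>/\<^sup>3\<close>. A block near the diagonal achieves this with probability bounded
  below. Far from the diagonal, or between distant columns, less is demanded: a path visiting column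
  \<open>j\<close> pays for the lateral excursion through the curvature in (LS), so the admissible level may grow
  like \<open>|j| / k\<close>, and the probability of failure is summable by (UT). All these events are decreasing,
  hence Harris' inequality bounds the probability of their intersection below by the product, which
  is \<open>exp (- O(k\<^sup>2)) = exp (- O(\<theta>\<^sup>3))\<close>.\<close>

section \<open>Directed paths and last passage values\<close>

text \<open>The assumptions concern single passage times, whereas every crossing between two columns
  has to be low at once. Both columns are therefore tied to fixed points somewhat below and above
  the slab: a high crossing would make the passage between these two points high, up to the loss on
  two connections. Slabs have height \<open>m * s\<close> with \<open>m\<close> a large constant,
  columns have width about \<open>s\<close> to the power 2/3, so the deficit that (LB) supplies at
  height \<open>m * s\<close> outweighs a loss at scale \<open>s\<close>. The obstacle is that a
  slab has far more pairs of columns than \<open>k\<close>: a fixed probability for each would make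
  the product much too small. The levels are set so that the pair \<open>j\<close>,
  \<open>j'\<close> costs a multiple of \<open>1 / ((1 + |j' - j|)^2 (1 + |j| / k)^2)\<close> in the
  exponent, hence one slab costs O(k) however many columns it has. Stretched exponential decay in
  (UT) gives this for every positive \<alpha>, which is why the exponent 3 does not involve
  \<alpha>. The upper limit on \<theta> keeps \<open>s\<close> above the threshold of the one-point
  estimates and the rounding error, of order \<open>k\<close>, below the gain.\<close>

definition nn_step :: "int \<times> int \<Rightarrow> int \<times> int \<Rightarrow> bool" where
  "nn_step x y \<longleftrightarrow> y = (fst x + 1, snd x) \<or> y = (fst x, snd x + 1)"

definition dominated :: "int \<times> int \<Rightarrow> int \<times> int \<Rightarrow> bool" where
  "dominated u v \<longleftrightarrow> fst u \<le> fst v \<and> snd u \<le> snd v"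

definition rect :: "int \<times> int \<Rightarrow> int \<times> int \<Rightarrow> (int \<times> int) set" where
  "rect u v = {fst u..fst v} \<times> {snd u..snd v}"

lemma finite_rect [simp]: "finite (rect u v)"
  by (simp add: rect_def)

lemma up_right_Nil [simp]: "up_right []"
  and up_right_single [simp]: "up_right [x]"
  by (auto simp: up_right_def)

lemma up_right_Cons2 [simp]: "up_right (x # y # \<gamma>) \<longleftrightarrow> nn_step x y \<and> up_right (y # \<gamma>)"
proof -
  have *: "(\<forall>i. P i) \<longleftrightarrow> P 0 \<and> (\<forall>i. P (Suc i))" for P :: "nat \<Rightarrow> bool"
    by (metis nat.exhaust)
  show ?thesis
    unfolding up_right_def by (subst *) (auto simp: nn_step_def)
qed

lemma up_right_append:
  "xs \<noteq> [] \<Longrightarrow> ys \<noteq> [] \<Longrightarrow>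
    up_right (xs @ ys) \<longleftrightarrow> up_right xs \<and> nn_step (last xs) (hd ys) \<and> up_right ys"
proof (induction xs)
  case (Cons x xs)
  show ?case
  proof (cases xs)
    case Nil
    then show ?thesis using Cons.prems by (cases ys) auto
  next
    case (Cons x' xs')
    then show ?thesis using Cons.IH Cons.prems by auto
  qed
qed simp

lemma up_right_map:
  assumes "\<And>x y. nn_step (f x) (f y) \<longleftrightarrow> nn_step x y"
  shows "up_right (map f \<gamma>) \<longleftrightarrow> up_right \<gamma>"
proof (induction \<gamma>)
  case (Cons x \<gamma>)
  then show ?case using assms by (cases \<gamma>) auto
qed simp

lemma up_right_bounds:
  assumes "up_right (x # \<gamma>)"
  shows "dominated x (last (x # \<gamma>))" "set (x # \<gamma>) \<subseteq> rect x (last (x # \<gamma>))"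
    "int (length \<gamma>) = fst (last (x # \<gamma>)) + snd (last (x # \<gamma>)) - fst x - snd x"
proof -
  have "dominated x (last (x # \<gamma>)) \<and> set (x # \<gamma>) \<subseteq> rect x (last (x # \<gamma>)) \<and>
    int (length \<gamma>) = fst (last (x # \<gamma>)) + snd (last (x # \<gamma>)) - fst x - snd x"
    using assms
  proof (induction \<gamma> arbitrary: x)
    case Nil
    then show ?case by (auto simp: dominated_def rect_def mem_Times_iff)
  next
    case (Cons y \<gamma>)
    then have st: "nn_step x y" and "up_right (y # \<gamma>)" by auto
    with Cons.IH[of y] have IH: "dominated y (last (y # \<gamma>))" "set (y # \<gamma>) \<subseteq> rect y (last (y # \<gamma>))"
      "int (length \<gamma>) = fst (last (y # \<gamma>)) + snd (last (y # \<gamma>)) - fst y - snd y" by auto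
    have l: "last (x # y # \<gamma>) = last (y # \<gamma>)" by simp
    have sub: "rect y (last (y # \<gamma>)) \<subseteq> rect x (last (y # \<gamma>))"
      using st by (auto simp: rect_def nn_step_def)
    have "dominated x (last (y # \<gamma>))"
      using st IH(1) by (auto simp: dominated_def nn_step_def)
    moreover from this have "set (x # y # \<gamma>) \<subseteq> rect x (last (y # \<gamma>))"
      using IH(2) sub by (auto simp: dominated_def rect_def mem_Times_iff simp del: last.simps)
    moreover have "int (length (y # \<gamma>)) = fst (last (y # \<gamma>)) + snd (last (y # \<gamma>)) - fst x - snd x"
      using st IH(3) by (auto simp: nn_step_def simp del: last.simps)
    ultimately show ?case by (simp only: l)
  qed
  then show "dominated x (last (x # \<gamma>))" "set (x # \<gamma>) \<subseteq> rect x (last (x # \<gamma>))"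
    "int (length \<gamma>) = fst (last (x # \<gamma>)) + snd (last (x # \<gamma>)) - fst x - snd x"
    by blast+
qed

lemma dpaths_dest:
  assumes "\<gamma> \<in> dpaths u v"
  shows "dominated u v" "set \<gamma> \<subseteq> rect u v" "int (length \<gamma>) = fst v + snd v - fst u - snd u + 1"
proof -
  obtain x \<gamma>' where g: "\<gamma> = x # \<gamma>'" using assms by (cases \<gamma>) (auto simp: dpaths_def)
  have u: "x = u" and v: "last (x # \<gamma>') = v" and ur: "up_right (x # \<gamma>')"
    using assms unfolding g dpaths_def by auto
  note B = up_right_bounds[OF ur, unfolded v, unfolded u]
  show "dominated u v" by (rule B(1))
  show "set \<gamma> \<subseteq> rect u v" unfolding g u by (rule B(2))
  show "int (length \<gamma>) = fst v + snd v - fst u - snd u + 1" unfolding g using B(3) by simp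
qed

text \<open>The rectangle and the fixed length leave finitely many lists, so the \<open>Max\<close>
  in \<open>lpp\<close> is a genuine maximum.\<close>

lemma finite_dpaths [simp]: "finite (dpaths u v)"
proof (rule finite_subset)
  show "dpaths u v \<subseteq> {xs. set xs \<subseteq> rect u v \<and> length xs = nat (fst v + snd v - fst u - snd u + 1)}"
  proof
    fix \<gamma> assume "\<gamma> \<in> dpaths u v"
    from dpaths_dest(2,3)[OF this]
    show "\<gamma> \<in> {xs. set xs \<subseteq> rect u v \<and> length xs = nat (fst v + snd v - fst u - snd u + 1)}"
      by (metis (mono_tags) mem_Collect_eq nat_int)
  qed
qed (simp add: finite_lists_length_eq)

lemma dpaths_nonempty:
  assumes "dominated u v" shows "dpaths u v \<noteq> {}"
  using assms
proof (induction "nat (fst v - fst u + (snd v - snd u))" arbitrary: u)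
  case 0
  then have "u = v" by (auto simp: dominated_def prod_eq_iff)
  then have "[u] \<in> dpaths u v" by (simp add: dpaths_def)
  then show ?case by blast
next
  case (Suc n)
  define y where "y = (if fst u < fst v then (fst u + 1, snd u) else (fst u, snd u + 1))"
  have "n = nat (fst v - fst y + (snd v - snd y))" "dominated y v"
    using Suc.hyps(2) Suc.prems by (auto simp: y_def dominated_def)
  from Suc.hyps(1)[OF this] obtain \<gamma> where g: "\<gamma> \<in> dpaths y v" by blast
  then have "u # \<gamma> \<in> dpaths u v"
    by (cases \<gamma>) (auto simp: dpaths_def nn_step_def y_def)
  then show ?case by blast
qed

lemma path_weight_le_lpp: "\<gamma> \<in> dpaths u v \<Longrightarrow> path_weight w \<gamma> \<le> lpp w u v"
  by (simp add: lpp_def)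

lemma lpp_attained:
  assumes "dominated u v"
  obtains \<gamma> where "\<gamma> \<in> dpaths u v" "lpp w u v = path_weight w \<gamma>"
proof -
  have "lpp w u v \<in> path_weight w ` dpaths u v"
    unfolding lpp_def using dpaths_nonempty[OF assms] by (intro Max_in) auto
  then show ?thesis using that by blast
qed

lemma lpp_le_iff:
  "dominated u v \<Longrightarrow> lpp w u v \<le> t \<longleftrightarrow> (\<forall>\<gamma>\<in>dpaths u v. path_weight w \<gamma> \<le> t)"
  using dpaths_nonempty by (simp add: lpp_def)

lemma lpp_mono:
  assumes "dominated u v" "\<And>x. x \<in> rect u v \<Longrightarrow> w x \<le> w' x"
  shows "lpp w u v \<le> lpp w' u v"
proof -
  obtain \<gamma> where g: "\<gamma> \<in> dpaths u v" "lpp w u v = path_weight w \<gamma>"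
    using lpp_attained[OF assms(1)] .
  have "path_weight w \<gamma> \<le> path_weight w' \<gamma>"
    unfolding path_weight_def using dpaths_dest(2)[OF g(1)] assms(2) by (intro sum_list_mono) auto
  with path_weight_le_lpp[OF g(1), of w'] g(2) show ?thesis by simp
qed

lemma lpp_cong:
  assumes "\<And>x. x \<in> rect u v \<Longrightarrow> w x = w' x"
  shows "lpp w u v = lpp w' u v"
proof -
  have "path_weight w \<gamma> = path_weight w' \<gamma>" if "\<gamma> \<in> dpaths u v" for \<gamma>
    unfolding path_weight_def
    using dpaths_dest(2)[OF that] assms by (intro arg_cong[of _ _ sum_list] map_cong) auto
  then show ?thesis unfolding lpp_def by (simp cong: image_cong)
qed

text \<open>Any symmetry of the step relation carries paths to paths. The instances are translations
  and the swap of coordinates, which reverses the lateral offset.\<close>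

lemma lpp_map:
  assumes f: "bij f" "\<And>x y. nn_step (f x) (f y) \<longleftrightarrow> nn_step x y"
  shows "lpp w (f u) (f v) = lpp (\<lambda>x. w (f x)) u v"
proof -
  have "dpaths (f u) (f v) = map f ` dpaths u v"
  proof (intro equalityI subsetI)
    fix \<gamma> assume g: "\<gamma> \<in> dpaths (f u) (f v)"
    define \<gamma>' where "\<gamma>' = map (inv f) \<gamma>"
    have m: "map f \<gamma>' = \<gamma>"
      by (simp add: \<gamma>'_def o_def surj_f_inv_f[OF bij_is_surj[OF f(1)]])
    have "up_right \<gamma>'" using g up_right_map[of f, OF f(2), of \<gamma>'] m by (simp add: dpaths_def)
    moreover have "\<gamma>' \<noteq> []" "hd \<gamma>' = u" "last \<gamma>' = v"
      using g f(1) by (auto simp: \<gamma>'_def dpaths_def hd_map last_map bij_is_inj)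
    ultimately have "\<gamma>' \<in> dpaths u v" by (simp add: dpaths_def)
    then show "\<gamma> \<in> map f ` dpaths u v" using m by blast
  next
    fix \<gamma> assume "\<gamma> \<in> map f ` dpaths u v"
    then show "\<gamma> \<in> dpaths (f u) (f v)"
      using up_right_map[of f, OF f(2)] by (auto simp: dpaths_def hd_map last_map)
  qed
  then show ?thesis
    by (simp add: lpp_def image_image path_weight_def o_def)
qed

lemma lpp_shift: "lpp w (u + a) (v + a) = lpp (\<lambda>x. w (x + a)) u v"
proof (rule lpp_map)
  show "bij (\<lambda>x. x + a)" by (rule bij_plus_right)
  show "nn_step (x + a) (y + a) \<longleftrightarrow> nn_step x y" for x y
    by (cases x; cases y; cases a) (auto simp: nn_step_def)
qed

lemma lpp_swap: "lpp w (prod.swap u) (prod.swap v) = lpp (\<lambda>x. w (prod.swap x)) u v"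
  by (rule lpp_map) (auto simp: nn_step_def prod_eq_iff)

text \<open>Two optimal paths are joined through the extra site \<open>u + (1, 0)\<close>, whose
  weight is dropped. Starting the second path at \<open>u + (1, 1)\<close> instead of
  \<open>u\<close> keeps the two pieces on disjoint sites, as independence requires.\<close>

lemma lpp_superadditive:
  assumes w: "\<And>x. 0 \<le> w x" and "dominated a u" "dominated (u + (1, 1)) b"
  shows "lpp w a u + lpp w (u + (1, 1)) b \<le> lpp w a b"
proof -
  obtain \<gamma>1 where g1: "\<gamma>1 \<in> dpaths a u" "lpp w a u = path_weight w \<gamma>1"
    using lpp_attained[OF assms(2)] .
  obtain \<gamma>2 where g2: "\<gamma>2 \<in> dpaths (u + (1, 1)) b" "lpp w (u + (1, 1)) b = path_weight w \<gamma>2"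
    using lpp_attained[OF assms(3)] .
  have "\<gamma>1 @ (u + (1, 0)) # \<gamma>2 \<in> dpaths a b"
    using g1(1) g2(1) up_right_append[of "[u + (1, 0)]" \<gamma>2]
      up_right_append[of \<gamma>1 "(u + (1, 0)) # \<gamma>2"]
    by (cases u) (auto simp: dpaths_def nn_step_def)
  from path_weight_le_lpp[OF this, of w] show ?thesis
    using g1(2) g2(2) w[of "u + (1, 0)"] by (simp add: path_weight_def)
qed

text \<open>Each step raises the coordinate sum by exactly one, so no antidiagonal is
  skipped.\<close>

lemma up_right_crosses_antidiagonal:
  assumes "up_right (x # \<gamma>)" "fst x + snd x \<le> L" "L \<le> fst (last (x # \<gamma>)) + snd (last (x # \<gamma>))"
  shows "\<exists>xs y ys. x # \<gamma> = xs @ y # ys \<and> fst y + snd y = L"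
  using assms
proof (induction \<gamma> arbitrary: x)
  case Nil
  then show ?case by (intro exI[of _ "[]"]) auto
next
  case (Cons z \<gamma>)
  show ?case
  proof (cases "fst x + snd x = L")
    case True
    then show ?thesis by (intro exI[of _ "[]"]) auto
  next
    case False
    then have "fst z + snd z \<le> L" using Cons.prems(1,2) by (auto simp: nn_step_def)
    moreover have "up_right (z # \<gamma>)" "L \<le> fst (last (z # \<gamma>)) + snd (last (z # \<gamma>))"
      using Cons.prems(1,3) by simp_all
    ultimately obtain xs y ys where "z # \<gamma> = xs @ y # ys" "fst y + snd y = L"
      using Cons.IH[of z] by blast
    then show ?thesis by (intro exI[of _ "x # xs"]) auto
  qed
qed

text \<open>An optimal path is cut where it meets the antidiagonal; the site there is counted in
  both pieces, so only an upper bound results.\<close>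

lemma lpp_split_antidiagonal:
  assumes w: "\<And>x. 0 \<le> w x" and ab: "dominated a b"
    and L: "fst a + snd a \<le> L" "L \<le> fst b + snd b"
  obtains c where "dominated a c" "dominated c b" "fst c + snd c = L"
    "lpp w a b \<le> lpp w a c + lpp w c b"
proof -
  obtain \<gamma> where g: "\<gamma> \<in> dpaths a b" "lpp w a b = path_weight w \<gamma>"
    using lpp_attained[OF ab] .
  obtain \<gamma>' where g': "\<gamma> = a # \<gamma>'" using g(1) by (cases \<gamma>) (auto simp: dpaths_def)
  have "\<exists>xs y ys. a # \<gamma>' = xs @ y # ys \<and> fst y + snd y = L"
    using g(1) L unfolding g' dpaths_def by (intro up_right_crosses_antidiagonal) auto
  then obtain xs y ys where s: "\<gamma> = xs @ y # ys" "fst y + snd y = L" using g' by metis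
  have 1: "xs @ [y] \<in> dpaths a y"
    using g(1) s up_right_append[of xs "y # ys"] up_right_append[of xs "[y]"]
    by (cases xs) (auto simp: dpaths_def)
  have 2: "y # ys \<in> dpaths y b"
    using g(1) s up_right_append[of xs "y # ys"] by (cases xs) (auto simp: dpaths_def)
  have "lpp w a b \<le> path_weight w (xs @ [y]) + path_weight w (y # ys)"
    using g(2) s w[of y] by (simp add: path_weight_def)
  also have "\<dots> \<le> lpp w a y + lpp w y b"
    by (intro add_mono path_weight_le_lpp 1 2)
  finally show ?thesis using that dpaths_dest(1)[OF 1] dpaths_dest(1)[OF 2] s(2) by blast
qed

section \<open>Harris' inequality\<close>

lemma (in prob_space) integrable_unit_interval:
  fixes f :: "'a \<Rightarrow> real"
  assumes "f \<in> borel_measurable M" "\<And>x. x \<in> space M \<Longrightarrow> f x \<in> {0..1}"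
  shows "integrable M f"
  using assms by (intro integrable_const_bound[where B = 1]) auto

lemma mult_unit_interval:
  "a \<in> {0..1} \<Longrightarrow> b \<in> {0..1} \<Longrightarrow> a * b \<in> {0..1}" for a b :: real
  by (auto intro: mult_le_one)

text \<open>For two independent samples \<open>(f x - f y) * (g x - g y)\<close> is nonnegative,
  both functions being decreasing; integrating over \<open>y\<close> and then over \<open>x\<close>
  gives twice the covariance.\<close>

lemma chebyshev_association:
  fixes f g :: "'a :: linorder \<Rightarrow> real"
  assumes "prob_space M"
    and f: "f \<in> borel_measurable M" "\<And>x. x \<in> space M \<Longrightarrow> f x \<in> {0..1}"
    "\<And>x y. x \<in> space M \<Longrightarrow> y \<in> space M \<Longrightarrow> x \<le> y \<Longrightarrow> f y \<le> f x"
    and g: "g \<in> borel_measurable M" "\<And>x. x \<in> space M \<Longrightarrow> g x \<in> {0..1}"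
    "\<And>x y. x \<in> space M \<Longrightarrow> y \<in> space M \<Longrightarrow> x \<le> y \<Longrightarrow> g y \<le> g x"
  shows "(\<integral>x. f x \<partial>M) * (\<integral>x. g x \<partial>M) \<le> (\<integral>x. f x * g x \<partial>M)"
proof -
  interpret prob_space M by fact
  have [simp]: "integrable M f" "integrable M g" using f g by (auto intro: integrable_unit_interval)
  have [simp]: "integrable M (\<lambda>x. f x * g x)"
    using f(1,2) g(1,2) by (intro integrable_unit_interval) (auto intro: mult_le_one)
  let ?F = "\<integral>x. f x \<partial>M" and ?G = "\<integral>x. g x \<partial>M" and ?FG = "\<integral>x. f x * g x \<partial>M"
  have 1: "0 \<le> f x * g x - f x * ?G - g x * ?F + ?FG" if x: "x \<in> space M" for x
  proof -
    have "0 \<le> (f x - f y) * (g x - g y)" if "y \<in> space M" for y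
      using f(3)[of x y] g(3)[of x y] f(3)[of y x] g(3)[of y x] x that
      by (cases "x \<le> y") (auto intro: mult_nonneg_nonneg mult_nonpos_nonpos)
    then have "0 \<le> (\<integral>y. (f x - f y) * (g x - g y) \<partial>M)"
      by (intro Bochner_Integration.integral_nonneg) auto
    also have "\<dots> = (\<integral>y. f x * g x - f x * g y - g x * f y + f y * g y \<partial>M)"
      by (simp add: algebra_simps)
    also have "\<dots> = f x * g x - f x * ?G - g x * ?F + ?FG"
      by (simp add: prob_space)
    finally show ?thesis .
  qed
  have "0 \<le> (\<integral>x. f x * g x - f x * ?G - g x * ?F + ?FG \<partial>M)"
    by (intro Bochner_Integration.integral_nonneg 1)
  also have "\<dots> = 2 * ?FG - 2 * (?F * ?G)"
    by (simp add: prob_space)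
  finally show ?thesis by simp
qed

text \<open>Integrating out one coordinate preserves monotonicity, so the
  one-dimensional association inequality iterates.\<close>

lemma harris_PiM:
  fixes \<nu> :: "real measure" and f g :: "('i \<Rightarrow> real) \<Rightarrow> real"
  assumes "prob_space \<nu>" "finite I"
    and "f \<in> borel_measurable (PiM I (\<lambda>_. \<nu>))" "g \<in> borel_measurable (PiM I (\<lambda>_. \<nu>))"
    and "\<And>x. x \<in> space (PiM I (\<lambda>_. \<nu>)) \<Longrightarrow> f x \<in> {0..1}"
      "\<And>x. x \<in> space (PiM I (\<lambda>_. \<nu>)) \<Longrightarrow> g x \<in> {0..1}"
    and "\<And>x y. x \<in> space (PiM I (\<lambda>_. \<nu>)) \<Longrightarrow> y \<in> space (PiM I (\<lambda>_. \<nu>)) \<Longrightarrow>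
        (\<And>v. v \<in> I \<Longrightarrow> x v \<le> y v) \<Longrightarrow> f y \<le> f x"
      "\<And>x y. x \<in> space (PiM I (\<lambda>_. \<nu>)) \<Longrightarrow> y \<in> space (PiM I (\<lambda>_. \<nu>)) \<Longrightarrow>
        (\<And>v. v \<in> I \<Longrightarrow> x v \<le> y v) \<Longrightarrow> g y \<le> g x"
  shows "(\<integral>x. f x \<partial>PiM I (\<lambda>_. \<nu>)) * (\<integral>x. g x \<partial>PiM I (\<lambda>_. \<nu>)) \<le> (\<integral>x. f x * g x \<partial>PiM I (\<lambda>_. \<nu>))"
  using assms(2-)
proof (induction I arbitrary: f g rule: finite_induct)
  case empty
  then show ?case by (simp add: PiM_empty lebesgue_integral_count_space_finite)
next
  case (insert i I)
  interpret nu: prob_space \<nu> by fact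
  interpret product_prob_space "\<lambda>_::'i. \<nu>" I by unfold_locales
  interpret Q: prob_space "PiM (insert i I) (\<lambda>_. \<nu>)" by (intro prob_space_PiM) (rule assms(1))
  let ?P = "PiM I (\<lambda>_. \<nu>)" and ?P' = "PiM (insert i I) (\<lambda>_. \<nu>)"
  have upd: "x(i := y) \<in> space ?P'" if "x \<in> space ?P" "y \<in> space \<nu>" for x y
    using that by (auto simp: space_PiM PiE_iff extensional_def)
  have meas1: "(\<lambda>y. h (x(i := y))) \<in> borel_measurable \<nu>"
    if "h \<in> borel_measurable ?P'" "x \<in> space ?P" for h :: "_ \<Rightarrow> real" and x
    using measurable_comp[OF measurable_component_update[of x I "\<lambda>_. \<nu>" i] that(1)] that(2) insert.hyps
    by (simp add: comp_def)
  have meas2: "(\<lambda>x. \<integral>y. h (x(i := y)) \<partial>\<nu>) \<in> borel_measurable ?P"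
    if h: "h \<in> borel_measurable ?P'" for h :: "_ \<Rightarrow> real"
  proof -
    have "(\<lambda>(x, y). h (x(i := y))) \<in> borel_measurable (?P \<Otimes>\<^sub>M \<nu>)"
      using measurable_comp[OF measurable_add_dim[of i I "\<lambda>_. \<nu>"] h] by (simp add: comp_def split_beta')
    then show ?thesis by (rule nu.borel_measurable_lebesgue_integral)
  qed
  have aux: "(\<integral>y. h (x(i := y)) \<partial>\<nu>) \<in> {0..1}" "integrable \<nu> (\<lambda>y. h (x(i := y)))"
    if "h \<in> borel_measurable ?P'" "x \<in> space ?P" "\<And>x. x \<in> space ?P' \<Longrightarrow> h x \<in> {0..1}"
    for h :: "_ \<Rightarrow> real" and x
  proof -
    show I: "integrable \<nu> (\<lambda>y. h (x(i := y)))"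
      using that upd by (intro nu.integrable_unit_interval meas1) auto
    have "0 \<le> (\<integral>y. h (x(i := y)) \<partial>\<nu>)"
      using that(3) upd[OF that(2)] by (intro Bochner_Integration.integral_nonneg) auto
    moreover have "(\<integral>y. h (x(i := y)) \<partial>\<nu>) \<le> 1"
      using that(3) upd[OF that(2)] by (intro nu.integral_le_const I AE_I2) auto
    ultimately show "(\<integral>y. h (x(i := y)) \<partial>\<nu>) \<in> {0..1}" by simp
  qed
  have anti: "(\<integral>y. h (z(i := y)) \<partial>\<nu>) \<le> (\<integral>y. h (x(i := y)) \<partial>\<nu>)"
    if "h \<in> borel_measurable ?P'" "\<And>x. x \<in> space ?P' \<Longrightarrow> h x \<in> {0..1}"
      "\<And>x y. x \<in> space ?P' \<Longrightarrow> y \<in> space ?P' \<Longrightarrow> (\<And>v. v \<in> insert i I \<Longrightarrow> x v \<le> y v) \<Longrightarrow> h y \<le> h x"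
      "x \<in> space ?P" "z \<in> space ?P" "\<And>v. v \<in> I \<Longrightarrow> x v \<le> z v"
    for h :: "_ \<Rightarrow> real" and x z
  proof (rule integral_mono)
    show "integrable \<nu> (\<lambda>y. h (z(i := y)))" "integrable \<nu> (\<lambda>y. h (x(i := y)))"
      using that(1,2,4,5) by (auto intro: aux(2))
    fix y assume "y \<in> space \<nu>"
    then show "h (z(i := y)) \<le> h (x(i := y))"
      using that(6) by (intro that(3) upd that(4,5)) auto
  qed
  note f = insert.prems(1,3,5) and g = insert.prems(2,4,6)
  have fg: "(\<lambda>x. f x * g x) \<in> borel_measurable ?P'" using f(1) g(1) by simp
  have fg01: "f x * g x \<in> {0..1}" if "x \<in> space ?P'" for x
    using f(2)[OF that] g(2)[OF that] by (auto intro: mult_le_one)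
  have "(\<integral>x. f x \<partial>?P') * (\<integral>x. g x \<partial>?P')
      = (\<integral>x. (\<integral>y. f (x(i := y)) \<partial>\<nu>) \<partial>?P) * (\<integral>x. (\<integral>y. g (x(i := y)) \<partial>\<nu>) \<partial>?P)"
    using f g insert.hyps
    by (intro arg_cong2[of _ _ _ _ "(*)"] product_integral_insert Q.integrable_unit_interval) auto
  also have "\<dots> \<le> (\<integral>x. (\<integral>y. f (x(i := y)) \<partial>\<nu>) * (\<integral>y. g (x(i := y)) \<partial>\<nu>) \<partial>?P)"
    by (intro insert.IH meas2 aux anti f g) auto
  also have "\<dots> \<le> (\<integral>x. (\<integral>y. f (x(i := y)) * g (x(i := y)) \<partial>\<nu>) \<partial>?P)"
  proof (rule integral_mono)
    show "integrable ?P (\<lambda>x. (\<integral>y. f (x(i := y)) \<partial>\<nu>) * (\<integral>y. g (x(i := y)) \<partial>\<nu>))"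
      by (intro P.integrable_unit_interval borel_measurable_times meas2 f g mult_unit_interval aux(1))
    show "integrable ?P (\<lambda>x. \<integral>y. f (x(i := y)) * g (x(i := y)) \<partial>\<nu>)"
      using aux(1)[OF fg _ fg01] meas2[OF fg] by (intro P.integrable_unit_interval) auto
    fix x assume x: "x \<in> space ?P"
    show "(\<integral>y. f (x(i := y)) \<partial>\<nu>) * (\<integral>y. g (x(i := y)) \<partial>\<nu>)
        \<le> (\<integral>y. f (x(i := y)) * g (x(i := y)) \<partial>\<nu>)"
    proof (rule chebyshev_association[OF assms(1)])
      fix y y' assume "y \<in> space \<nu>" "y' \<in> space \<nu>" "y \<le> y'"
      then show "f (x(i := y')) \<le> f (x(i := y))" "g (x(i := y')) \<le> g (x(i := y))"
        using upd[OF x] by (auto intro!: f g)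
    qed (intro meas1 f(1) g(1) x f(2) g(2) upd; assumption)+
  qed
  also have "\<dots> = (\<integral>x. f x * g x \<partial>?P')"
    using product_integral_insert[OF insert.hyps(1,2) Q.integrable_unit_interval[OF fg fg01]] by simp
  finally show ?case .
qed

section \<open>The product environment\<close>

text \<open>The events are predicates on weight configurations; a configuration is drawn from the
  infinite product \<open>env\<close>, whose underlying space is the full function type.\<close>

locale iid_field = prob_space \<nu> for \<nu> :: "real measure" +
  assumes sets_nu [measurable_cong]: "sets \<nu> = sets borel"
    and nu_nonneg: "AE x in \<nu>. 0 \<le> x"
begin

definition env :: "(int \<times> int \<Rightarrow> real) measure" where
  "env = PiM UNIV (\<lambda>_. \<nu>)"

definition pr :: "((int \<times> int \<Rightarrow> real) \<Rightarrow> bool) \<Rightarrow> real" where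
  "pr Q = measure env {w. Q w}"

lemma space_nu [simp]: "space \<nu> = UNIV"
  using sets_eq_imp_space_eq[OF sets_nu] by simp

lemma space_env [simp]: "space env = UNIV"
  by (simp add: env_def space_PiM)

sublocale E: prob_space env
  unfolding env_def by (intro prob_space_PiM) (rule prob_space_axioms)

lemma measurable_coord [measurable]: "(\<lambda>w. w v) \<in> borel_measurable env"
proof -
  have "(\<lambda>w. w v) \<in> measurable env \<nu>" unfolding env_def by measurable
  then show ?thesis by (simp add: measurable_cong_sets[OF refl sets_nu])
qed

lemma measurable_path_weight [measurable]: "(\<lambda>w. path_weight w \<gamma>) \<in> borel_measurable env"
  unfolding path_weight_def by (induction \<gamma>) auto

lemma measurable_lpp [measurable]: "(\<lambda>w. lpp w u v) \<in> borel_measurable env"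
proof (cases "dominated u v")
  case True
  show ?thesis
  proof (rule borel_measurableI_le)
    fix t
    have "Measurable.pred env (\<lambda>w. \<forall>\<gamma>\<in>dpaths u v. path_weight w \<gamma> \<le> t)"
      by (intro pred_intros_finite) auto
    then show "{w \<in> space env. lpp w u v \<le> t} \<in> sets env"
      using True by (simp add: lpp_le_iff pred_def)
  qed
next
  case False
  \<comment> \<open>Without a path \<open>lpp\<close> is the constant \<open>Max {}\<close>.\<close>
  then have "dpaths u v = {}" using dpaths_dest(1) by blast
  then show ?thesis by (simp add: lpp_def)
qed

lemma pred_sets [simp]: "Measurable.pred env Q \<Longrightarrow> {w. Q w} \<in> sets env"
  by (simp add: pred_def)

lemma AE_env_nonneg: "AE w in env. \<forall>v. 0 \<le> w v"
  unfolding AE_all_countable env_def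
  by (intro allI AE_PiM_component[where P = "\<lambda>x. 0 \<le> x"] nu_nonneg prob_space_axioms) auto

lemma pr_nonneg [simp]: "0 \<le> pr Q" and pr_le_1 [simp]: "pr Q \<le> 1"
  by (simp_all add: pr_def)

text \<open>\<nu> is a measure on the whole line, so weights are nonnegative only almost surely.
  This rule admits pathwise comparisons that drop weights.\<close>

lemma pr_mono_nonneg:
  assumes "\<And>w. (\<And>v. 0 \<le> w v) \<Longrightarrow> Q w \<Longrightarrow> R w" "Measurable.pred env R"
  shows "pr Q \<le> pr R"
  unfolding pr_def using AE_env_nonneg assms
  by (intro E.finite_measure_mono_AE) auto

lemma pr_mono: "(\<And>w. Q w \<Longrightarrow> R w) \<Longrightarrow> Measurable.pred env R \<Longrightarrow> pr Q \<le> pr R"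
  by (rule pr_mono_nonneg) auto

lemma pr_not: "Measurable.pred env Q \<Longrightarrow> pr (\<lambda>w. \<not> Q w) = 1 - pr Q"
  unfolding pr_def using E.prob_compl[of "{w. Q w}"] by (simp add: Compl_eq_Diff_UNIV[symmetric] Collect_neg_eq)

lemma pr_union:
  "Measurable.pred env Q \<Longrightarrow> Measurable.pred env R \<Longrightarrow> pr (\<lambda>w. Q w \<or> R w) \<le> pr Q + pr R"
  unfolding pr_def using measure_Un_le[of "{w. Q w}" env "{w. R w}"] by (simp add: Collect_disj_eq)

lemma pr_UN:
  assumes "finite T" "\<And>e. e \<in> T \<Longrightarrow> Measurable.pred env (Q e)"
    and "\<And>e e' w. e \<in> T \<Longrightarrow> e' \<in> T \<Longrightarrow> Q e w \<Longrightarrow> Q e' w \<Longrightarrow> e = e'"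
  shows "pr (\<lambda>w. \<exists>e\<in>T. Q e w) = (\<Sum>e\<in>T. pr (Q e))"
proof -
  have "{w. \<exists>e\<in>T. Q e w} = (\<Union>e\<in>T. {w. Q e w})" by auto
  then show ?thesis
    unfolding pr_def using assms
    by (simp, intro E.finite_measure_finite_Union) (auto simp: disjoint_family_on_def)
qed

text \<open>A product of identical laws is invariant under permutations of the sites; hence passage
  times are stationary under translation and symmetric under reflection.\<close>

lemma pr_reindex:
  assumes "bij f" "Measurable.pred env Q"
  shows "pr (\<lambda>w. Q (\<lambda>v. w (f v))) = pr Q"
proof -
  have [measurable]: "Measurable.pred env Q" by fact
  have m: "(\<lambda>w v. w (f v)) \<in> measurable env env"
    unfolding env_def by (rule measurable_PiM_single') (auto simp: space_PiM)
  have "distr env env (\<lambda>w v. w (f v)) = env"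
    using distr_PiM_reindex[of UNIV "\<lambda>_. \<nu>" f UNIV] assms(1)
    by (simp add: env_def bij_is_inj prob_space_axioms restrict_def)
  then have "pr Q = measure (distr env env (\<lambda>w v. w (f v))) {w. Q w}" by (simp add: pr_def)
  also have "\<dots> = pr (\<lambda>w. Q (\<lambda>v. w (f v)))"
    unfolding pr_def using m by (subst measure_distr) (auto simp: vimage_def)
  finally show ?thesis by simp
qed

lemma pr_lpp_shift:
  "Measurable.pred borel R \<Longrightarrow> pr (\<lambda>w. R (lpp w (u + a) (v + a))) = pr (\<lambda>w. R (lpp w u v))"
  unfolding lpp_shift
  by (rule pr_reindex[of "\<lambda>x. x + a" "\<lambda>w. R (lpp w u v)"]) (auto intro: bij_plus_right)

lemma pr_lpp_swap:
  "Measurable.pred borel R \<Longrightarrow>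
    pr (\<lambda>w. R (lpp w (prod.swap u) (prod.swap v))) = pr (\<lambda>w. R (lpp w u v))"
  unfolding lpp_swap
  by (rule pr_reindex[of prod.swap "\<lambda>w. R (lpp w u v)"]) auto

section \<open>Events determined by a set of sites: independence and association\<close>

definition depends_on :: "(int \<times> int) set \<Rightarrow> ((int \<times> int \<Rightarrow> real) \<Rightarrow> bool) \<Rightarrow> bool" where
  "depends_on F Q \<longleftrightarrow> (\<forall>w w'. (\<forall>v\<in>F. w v = w' v) \<longrightarrow> Q w = Q w')"

lemma depends_on_pred:
  assumes "depends_on F Q" "Measurable.pred env Q"
  shows "Measurable.pred (PiM F (\<lambda>_. \<nu>)) Q"
proof -
  \<comment> \<open>Partial configurations are extended by the value 0; \<open>Q\<close> looks only
    at \<open>F\<close>, so it does not see this default.\<close>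
  have m: "(\<lambda>w v. if v \<in> F then w v else 0) \<in> measurable (PiM F (\<lambda>_. \<nu>)) env"
    unfolding env_def
  proof (rule measurable_PiM_single')
    show "(\<lambda>w. if v \<in> F then w v else 0) \<in> measurable (PiM F (\<lambda>_. \<nu>)) \<nu>" for v
      by (cases "v \<in> F") auto
  qed (auto simp: space_PiM)
  have "(\<lambda>w. Q (\<lambda>v. if v \<in> F then w v else 0)) = Q"
    using assms(1) by (auto simp: depends_on_def fun_eq_iff)
  with measurable_compose[OF m assms(2)] show ?thesis by simp
qed

lemma pr_indep:
  assumes "depends_on F Q" "depends_on G R" "F \<inter> G = {}"
    and [measurable]: "Measurable.pred env Q" "Measurable.pred env R"
  shows "pr (\<lambda>w. Q w \<and> R w) = pr Q * pr R"
proof -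
  \<comment> \<open>The joint law of the coordinates is the product of their marginals by
    construction, and restrictions to disjoint sets of sites inherit independence.\<close>
  have iv: "E.indep_vars (\<lambda>_. \<nu>) (\<lambda>v w. w v) UNIV"
  proof (subst E.indep_vars_iff_distr_eq_PiM)
    show "(\<lambda>w. w i) \<in> measurable env \<nu>" for i unfolding env_def by measurable
    have "distr env (PiM UNIV (\<lambda>_. \<nu>)) (\<lambda>x. x) = PiM UNIV (\<lambda>_. \<nu>)"
      unfolding env_def by (rule distr_id2) simp
    moreover have "distr env \<nu> (\<lambda>w. w i) = \<nu>" for i
      unfolding env_def by (rule distr_PiM_component) (auto intro: prob_space_axioms)
    ultimately show "distr env (Pi\<^sub>M UNIV (\<lambda>_. \<nu>)) (\<lambda>x. \<lambda>i\<in>UNIV. x i)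
        = (\<Pi>\<^sub>M i\<in>UNIV. distr env \<nu> (\<lambda>w. w i))" by (simp add: restrict_def)
  qed simp
  have Q: "Q (restrict w F) = Q w" and R: "R (restrict w G) = R w" for w
    using assms(1,2) by (auto simp: depends_on_def)
  have mQ: "{w \<in> space (PiM F (\<lambda>_. \<nu>)). Q w} \<in> sets (PiM F (\<lambda>_. \<nu>))"
    and mR: "{w \<in> space (PiM G (\<lambda>_. \<nu>)). R w} \<in> sets (PiM G (\<lambda>_. \<nu>))"
    using depends_on_pred[OF assms(1)] depends_on_pred[OF assms(2)] by auto
  have sp: "restrict w K \<in> space (PiM K (\<lambda>_. \<nu>))" for w and K :: "(int \<times> int) set"
    by (simp add: space_PiM)
  from E.indep_varD[OF E.indep_var_restrict[OF iv assms(3)] mQ mR]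
  show ?thesis
    using sp by (simp add: pr_def vimage_def Q R)
qed

definition decreasing_on :: "(int \<times> int) set \<Rightarrow> ((int \<times> int \<Rightarrow> real) \<Rightarrow> bool) \<Rightarrow> bool" where
  "decreasing_on F Q \<longleftrightarrow> (\<forall>w w'. (\<forall>v\<in>F. w v \<le> w' v) \<longrightarrow> Q w' \<longrightarrow> Q w)"

lemma decreasing_on_depends_on: "decreasing_on F Q \<Longrightarrow> depends_on F Q"
  unfolding decreasing_on_def depends_on_def by (metis order_refl)

text \<open>The induction behind Harris' inequality lives on finite products; this identifies
  probabilities in the infinite environment with integrals over the sites that matter.\<close>

lemma pr_restrict:
  assumes "depends_on F Q" "Measurable.pred env Q"
  shows "pr Q = (\<integral>w. of_bool (Q w) \<partial>PiM F (\<lambda>_. \<nu>))"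
proof -
  interpret PF: prob_space "PiM F (\<lambda>_. \<nu>)" by (intro prob_space_PiM prob_space_axioms)
  let ?P = "PiM F (\<lambda>_. \<nu>)"
  have [measurable]: "Measurable.pred ?P Q" using depends_on_pred[OF assms] .
  have m: "(\<lambda>w. restrict w F) \<in> measurable env ?P"
    unfolding env_def by (rule measurable_restrict_subset) simp
  have "distr env ?P (\<lambda>w. restrict w F) = ?P"
    using distr_PiM_reindex[of UNIV "\<lambda>_. \<nu>" "\<lambda>x. x" F] by (simp add: env_def prob_space_axioms)
  moreover have "(\<integral>w. of_bool (Q w) \<partial>?P) = measure ?P {w \<in> space ?P. Q w}"
    by (subst Bochner_Integration.integral_cong[OF refl, of _ _ "indicator {w \<in> space ?P. Q w}"])
      (auto simp: indicator_def)
  ultimately have "(\<integral>w. of_bool (Q w) \<partial>?P) = measure (distr env ?P (\<lambda>w. restrict w F)) {w \<in> space ?P. Q w}"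
    by simp
  also have "\<dots> = measure env {w. Q (restrict w F)}"
  proof -
    have "{w \<in> space ?P. Q w} \<in> sets ?P" by measurable
    from measure_distr[OF m this] show ?thesis by (simp add: vimage_def space_PiM)
  qed
  also have "\<dots> = pr Q"
  proof -
    have "Q (restrict w F) = Q w" for w
      using assms(1) by (auto simp: depends_on_def)
    then show ?thesis by (simp add: pr_def)
  qed
  finally show ?thesis by simp
qed

lemma harris:
  assumes "finite F" "decreasing_on F Q" "decreasing_on F R"
    and [measurable]: "Measurable.pred env Q" "Measurable.pred env R"
  shows "pr Q * pr R \<le> pr (\<lambda>w. Q w \<and> R w)"
proof -
  have d: "depends_on F Q" "depends_on F R" "depends_on F (\<lambda>w. Q w \<and> R w)"
    using assms(2,3)[THEN decreasing_on_depends_on] by (auto simp: depends_on_def)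
  have [measurable]: "Measurable.pred (PiM F (\<lambda>_. \<nu>)) Q" "Measurable.pred (PiM F (\<lambda>_. \<nu>)) R"
    by (intro depends_on_pred d assms)+
  have "pr Q * pr R \<le> (\<integral>w. of_bool (Q w) * of_bool (R w) \<partial>PiM F (\<lambda>_. \<nu>))"
    unfolding pr_restrict[OF d(1) assms(4)] pr_restrict[OF d(2) assms(5)]
  proof (rule harris_PiM[OF prob_space_axioms assms(1)])
    fix x y :: "int \<times> int \<Rightarrow> real" assume "\<And>v. v \<in> F \<Longrightarrow> x v \<le> y v"
    then have "Q y \<Longrightarrow> Q x" "R y \<Longrightarrow> R x"
      using assms(2,3) unfolding decreasing_on_def by blast+
    then show "of_bool (Q y) \<le> (of_bool (Q x) :: real)" "of_bool (R y) \<le> (of_bool (R x) :: real)"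
      by auto
  qed auto
  also have "\<dots> = pr (\<lambda>w. Q w \<and> R w)"
    by (subst pr_restrict[OF d(3)]) (auto simp: of_bool_conj)
  finally show ?thesis .
qed

text \<open>All events refer to one common finite \<open>F\<close>, so a conjunction of them is
  again decreasing on \<open>F\<close> and the inequality for two events iterates.\<close>

lemma harris_finite:
  assumes "finite T" "finite F" "\<And>e. e \<in> T \<Longrightarrow> decreasing_on F (Q e)"
    and "\<And>e. e \<in> T \<Longrightarrow> Measurable.pred env (Q e)"
  shows "(\<Prod>e\<in>T. pr (Q e)) \<le> pr (\<lambda>w. \<forall>e\<in>T. Q e w)"
  using assms(1,3,4)
proof (induction T rule: finite_induct)
  case empty
  then show ?case using E.prob_space by (simp add: pr_def)
next
  case (insert e T)
  have "(\<Prod>e\<in>insert e T. pr (Q e)) \<le> pr (Q e) * pr (\<lambda>w. \<forall>e\<in>T. Q e w)"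
    using insert by (simp add: mult_left_mono)
  also have "\<dots> \<le> pr (\<lambda>w. Q e w \<and> (\<forall>e\<in>T. Q e w))"
  proof (rule harris[OF assms(2)])
    have "decreasing_on F (Q e)" if "e \<in> T" for e using insert.prems(1) that by simp
    then show "decreasing_on F (\<lambda>w. \<forall>e\<in>T. Q e w)" unfolding decreasing_on_def by blast
    show "Measurable.pred env (\<lambda>w. \<forall>e\<in>T. Q e w)"
      using insert.hyps(1) insert.prems(2) by (intro pred_intros_finite) auto
  qed (use insert.prems in auto)
  finally show ?case by simp
qed

end

section \<open>Crossings of a slab\<close>

text \<open>Diagonal coordinates: \<open>p\<close> is the height along the diagonal,
  \<open>x\<close> the lateral offset. Exactly the lattice points with even coordinate sum have this
  form, which suffices because slab boundaries lie on even antidiagonals.\<close>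

definition pt :: "int \<Rightarrow> int \<Rightarrow> int \<times> int" where
  "pt p x = (p - x, p + x)"

lemma pt_add_one: "pt p x + (1, 1) = pt (p + 1) x"
  by (simp add: pt_def)

lemma dominated_pt: "dominated (pt p x) (pt q y) \<longleftrightarrow> \<bar>y - x\<bar> \<le> q - p"
  by (auto simp: dominated_def pt_def)

text \<open>A slab ending at height \<open>p - 1\<close> and one starting at height \<open>p\<close>
  are disjoint; the odd antidiagonal between them carries the joining site of
  \<open>lpp_superadditive\<close>.\<close>

definition slab :: "int \<Rightarrow> int \<Rightarrow> (int \<times> int) set" where
  "slab l h = {v. 2 * l \<le> fst v + snd v \<and> fst v + snd v \<le> 2 * h}"

lemma rect_pt_slab: "rect (pt p x) (pt q y) \<subseteq> slab p q"
  by (auto simp: rect_def slab_def pt_def)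

text \<open>With an injective rank, choosing the witness of least rank turns an overlapping union
  into a disjoint one, whose probability is a sum.\<close>

lemma first_witness:
  fixes h :: "'e \<Rightarrow> nat"
  assumes "\<exists>e\<in>T. Q e"
  shows "\<exists>e\<in>T. Q e \<and> (\<forall>e'\<in>T. h e' < h e \<longrightarrow> \<not> Q e')"
proof -
  define n where "n = (LEAST n. \<exists>e\<in>T. Q e \<and> h e = n)"
  have "\<exists>e\<in>T. Q e \<and> h e = n"
    unfolding n_def by (rule LeastI_ex) (use assms in auto)
  moreover have "\<not> Q e'" if "e' \<in> T" "h e' < n" for e'
    using not_less_Least[of "h e'" "\<lambda>n. \<exists>e\<in>T. Q e \<and> h e = n"] that unfolding n_def by blast
  ultimately show ?thesis by blast
qed

context iid_field
begin

lemma depends_on_lpp: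
  assumes "rect u v \<subseteq> F" shows "depends_on F (\<lambda>w. R (lpp w u v))"
  unfolding depends_on_def using assms lpp_cong[of u v] by (metis subsetD)

text \<open>The \<open>- 1\<close> is there because the passage from \<open>(1, 1)\<close> to height
  \<open>n\<close> climbs only \<open>n - 1\<close> heights.\<close>

lemma pr_lpp_pt:
  assumes "Measurable.pred borel R" "q = p + int n - 1" "y = x + z"
  shows "pr (\<lambda>w. R (lpp w (pt p x) (pt q y))) = pr (\<lambda>w. R (lpp w (1, 1) (int n - z, int n + z)))"
proof -
  have "pt p x = (1, 1) + (pt p x - (1, 1))" "pt q y = (int n - z, int n + z) + (pt p x - (1, 1))"
    using assms by (auto simp: pt_def)
  with pr_lpp_shift[OF assms(1), of "(1, 1)" "pt p x - (1, 1)" "(int n - z, int n + z)"]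
  show ?thesis by simp
qed

text \<open>A crossing of the middle slab that is heavier than \<open>t\<close> is selected using the weights of that
  slab only, so it is independent of the connections to \<open>\<phi>\<close> and \<open>\<psi>\<close>, each of which is heavy enough
  with probability at least \<open>1 - \<epsilon>\<close>. In particular no uniform control over \<open>A\<close> or \<open>B\<close> of the
  connections is needed.\<close>

lemma sandwich:
  assumes fin: "finite A" "finite B"
    and low: "\<And>x. x \<in> A \<Longrightarrow> pr (\<lambda>w. lpp w (pt p' x0) (pt (p - 1) x) < a) \<le> \<epsilon>"
      "\<And>x. x \<in> A \<Longrightarrow> \<bar>x - x0\<bar> \<le> p - 1 - p'"
    and up: "\<And>y. y \<in> B \<Longrightarrow> pr (\<lambda>w. lpp w (pt (q + 1) y) (pt q' y0) < a) \<le> \<epsilon>"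
      "\<And>y. y \<in> B \<Longrightarrow> \<bar>y0 - y\<bar> \<le> q' - (q + 1)"
  shows "pr (\<lambda>w. \<exists>x\<in>A. \<exists>y\<in>B. \<bar>y - x\<bar> \<le> q - p \<and> t < lpp w (pt p x) (pt q y)) * (1 - 2 * \<epsilon>)
    \<le> pr (\<lambda>w. t + 2 * a < lpp w (pt p' x0) (pt q' y0))"
proof -
  define T where "T = {e \<in> A \<times> B. \<bar>snd e - fst e\<bar> \<le> q - p}"
  have [simp]: "finite T" using fin by (simp add: T_def)
  \<comment> \<open>A ranking of the pairs: \<open>D e\<close> says that \<open>e\<close> is the
    first heavy pair. These events are disjoint and still decided by the middle slab alone.\<close>
  obtain h :: "int \<times> int \<Rightarrow> nat" where h: "inj_on h T"
    using finite_imp_inj_to_nat_seg[OF \<open>finite T\<close>] by blast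
  define H where "H e w \<longleftrightarrow> t < lpp w (pt p (fst e)) (pt q (snd e))" for e w
  define D where "D e w \<longleftrightarrow> H e w \<and> (\<forall>e'\<in>T. h e' < h e \<longrightarrow> \<not> H e' w)" for e w
  define lo where "lo e w \<longleftrightarrow> lpp w (pt p' x0) (pt (p - 1) (fst e)) < a" for e :: "int \<times> int" and w
  define hi where "hi e w \<longleftrightarrow> lpp w (pt (q + 1) (snd e)) (pt q' y0) < a" for e :: "int \<times> int" and w
  have mH [measurable]: "Measurable.pred env (H e)" for e unfolding H_def by measurable
  have mD [measurable]: "Measurable.pred env (D e)" for e
    unfolding D_def by (intro pred_intros_logic pred_intros_finite mH) auto
  have [measurable]: "Measurable.pred env (lo e)" "Measurable.pred env (hi e)" for e
    unfolding lo_def hi_def by measurable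
  have dH: "depends_on (slab p q) (H e)" for e
    unfolding H_def by (intro depends_on_lpp[where R = "\<lambda>x. t < x"] rect_pt_slab)
  have dD: "depends_on (slab p q) (D e)" for e
    using dH unfolding depends_on_def D_def by meson
  have dlo: "depends_on (slab p' (p - 1)) (lo e)" for e
    unfolding lo_def by (intro depends_on_lpp[where R = "\<lambda>x. x < a"] rect_pt_slab)
  have dhi: "depends_on (slab (q + 1) q') (hi e)" for e
    unfolding hi_def by (intro depends_on_lpp[where R = "\<lambda>x. x < a"] rect_pt_slab)
  have part: "pr (D e) * (1 - 2 * \<epsilon>) \<le> pr (\<lambda>w. D e w \<and> \<not> lo e w \<and> \<not> hi e w)" if "e \<in> T" for e
  proof -
    have e: "fst e \<in> A" "snd e \<in> B" using that by (auto simp: T_def)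
    have "pr (\<lambda>w. D e w \<and> lo e w) = pr (D e) * pr (lo e)"
      by (rule pr_indep[OF dD dlo]) (auto simp: slab_def)
    also have "\<dots> \<le> pr (D e) * \<epsilon>"
      using low(1)[OF e(1)] by (intro mult_left_mono) (auto simp: lo_def[abs_def])
    finally have 1: "pr (\<lambda>w. D e w \<and> lo e w) \<le> pr (D e) * \<epsilon>" .
    have "pr (\<lambda>w. D e w \<and> hi e w) = pr (D e) * pr (hi e)"
      by (rule pr_indep[OF dD dhi]) (auto simp: slab_def)
    also have "\<dots> \<le> pr (D e) * \<epsilon>"
      using up(1)[OF e(2)] by (intro mult_left_mono) (auto simp: hi_def[abs_def])
    finally have 2: "pr (\<lambda>w. D e w \<and> hi e w) \<le> pr (D e) * \<epsilon>" .
    have "pr (D e) \<le> pr (\<lambda>w. (D e w \<and> \<not> lo e w \<and> \<not> hi e w) \<or> (D e w \<and> lo e w) \<or> (D e w \<and> hi e w))"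
      by (rule pr_mono) auto
    also have "\<dots> \<le> pr (\<lambda>w. D e w \<and> \<not> lo e w \<and> \<not> hi e w) + pr (\<lambda>w. (D e w \<and> lo e w) \<or> (D e w \<and> hi e w))"
      by (rule pr_union) auto
    also have "pr (\<lambda>w. (D e w \<and> lo e w) \<or> (D e w \<and> hi e w)) \<le> pr (\<lambda>w. D e w \<and> lo e w) + pr (\<lambda>w. D e w \<and> hi e w)"
      by (rule pr_union) auto
    finally show ?thesis using 1 2 by (simp add: algebra_simps)
  qed
  have uniq: "e = e'" if "e \<in> T" "e' \<in> T" "D e w" "D e' w" for e e' w
  proof -
    have "\<not> h e' < h e" "\<not> h e < h e'" using that unfolding D_def by blast+
    then show ?thesis using that h by (auto dest: inj_onD)
  qed
  have "pr (\<lambda>w. \<exists>x\<in>A. \<exists>y\<in>B. \<bar>y - x\<bar> \<le> q - p \<and> t < lpp w (pt p x) (pt q y)) \<le> pr (\<lambda>w. \<exists>e\<in>T. D e w)"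
  proof (rule pr_mono)
    fix w assume "\<exists>x\<in>A. \<exists>y\<in>B. \<bar>y - x\<bar> \<le> q - p \<and> t < lpp w (pt p x) (pt q y)"
    then have "\<exists>e\<in>T. H e w" by (force simp: T_def H_def)
    from first_witness[OF this, of h] show "\<exists>e\<in>T. D e w" by (simp add: D_def)
  qed (intro pred_intros_finite; simp)
  also have "pr (\<lambda>w. \<exists>e\<in>T. D e w) = (\<Sum>e\<in>T. pr (D e))"
    by (rule pr_UN) (use uniq in \<open>blast | simp\<close>)+
  finally have 1: "pr (\<lambda>w. \<exists>x\<in>A. \<exists>y\<in>B. \<bar>y - x\<bar> \<le> q - p \<and> t < lpp w (pt p x) (pt q y)) \<le> (\<Sum>e\<in>T. pr (D e))" .
  have "(\<Sum>e\<in>T. pr (D e)) * (1 - 2 * \<epsilon>) \<le> (\<Sum>e\<in>T. pr (\<lambda>w. D e w \<and> \<not> lo e w \<and> \<not> hi e w))"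
    unfolding sum_distrib_right by (intro sum_mono part)
  also have "\<dots> = pr (\<lambda>w. \<exists>e\<in>T. D e w \<and> \<not> lo e w \<and> \<not> hi e w)"
    by (rule pr_UN[symmetric]) (use uniq in \<open>blast | simp\<close>)+
  also have "\<dots> \<le> pr (\<lambda>w. t + 2 * a < lpp w (pt p' x0) (pt q' y0))"
  proof (rule pr_mono_nonneg)
    fix w :: "int \<times> int \<Rightarrow> real" assume w: "\<And>v. 0 \<le> w v"
      and "\<exists>e\<in>T. D e w \<and> \<not> lo e w \<and> \<not> hi e w"
    then obtain x y where e: "x \<in> A" "y \<in> B" "\<bar>y - x\<bar> \<le> q - p" and l: "t < lpp w (pt p x) (pt q y)"
      "a \<le> lpp w (pt p' x0) (pt (p - 1) x)" "a \<le> lpp w (pt (q + 1) y) (pt q' y0)"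
      by (auto simp: T_def D_def H_def lo_def hi_def)
    have "lpp w (pt p' x0) (pt (p - 1) x) + lpp w (pt p x) (pt q' y0) \<le> lpp w (pt p' x0) (pt q' y0)"
      using lpp_superadditive[of w "pt p' x0" "pt (p - 1) x" "pt q' y0"] w low(2)[OF e(1)] up(2)[OF e(2)] e(3)
      by (simp add: pt_add_one dominated_pt)
    moreover have "lpp w (pt p x) (pt q y) + lpp w (pt (q + 1) y) (pt q' y0) \<le> lpp w (pt p x) (pt q' y0)"
      using lpp_superadditive[of w "pt p x" "pt q y" "pt q' y0"] w up(2)[OF e(2)] e(3)
      by (simp add: pt_add_one dominated_pt)
    ultimately show "t + 2 * a < lpp w (pt p' x0) (pt q' y0)" using l by linarith
  qed measurable
  finally have 2: "(\<Sum>e\<in>T. pr (D e)) * (1 - 2 * \<epsilon>) \<le> pr (\<lambda>w. t + 2 * a < lpp w (pt p' x0) (pt q' y0))" .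
  show ?thesis
  proof (cases "1 - 2 * \<epsilon> \<ge> 0")
    case True
    then show ?thesis using mult_right_mono[OF 1 True] 2 by linarith
  next
    case False
    then have "pr (\<lambda>w. \<exists>x\<in>A. \<exists>y\<in>B. \<bar>y - x\<bar> \<le> q - p \<and> t < lpp w (pt p x) (pt q y)) * (1 - 2 * \<epsilon>) \<le> 0"
      by (intro mult_nonneg_nonpos) auto
    then show ?thesis by (meson order.trans pr_nonneg)
  qed
qed

end

section \<open>One-point estimates\<close>

lemma powr_third_cubed: "0 \<le> x \<Longrightarrow> (x powr (1/3)) ^ 3 = x" for x :: real
  by (cases "x = 0") (simp_all add: powr_power)

lemma exp_powr_le_small:
  fixes c \<alpha> \<epsilon> :: real
  assumes "0 < c" "0 < \<alpha>" "0 < \<epsilon>"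
  shows "\<exists>\<theta>>\<theta>0. exp (- c * \<theta> powr \<alpha>) \<le> \<epsilon>"
proof -
  have "((\<lambda>\<theta>::real. exp (- c * \<theta> powr \<alpha>)) \<longlongrightarrow> 0) at_top"
    using assms by real_asymp
  then have "\<forall>\<^sub>F \<theta> in at_top. exp (- c * \<theta> powr \<alpha>) < \<epsilon>"
    using assms(3) by (auto dest: order_tendstoD)
  then have "\<forall>\<^sub>F \<theta> in at_top. exp (- c * \<theta> powr \<alpha>) < \<epsilon> \<and> \<theta>0 < \<theta>"
    using eventually_gt_at_top[of \<theta>0] by eventually_elim simp
  then show ?thesis
    using eventually_happens[of _ "at_top :: real filter"] by (fastforce simp: less_imp_le)
qed

section \<open>Columns, block events and the consequences of the one-point assumptions\<close>

definition col :: "int \<Rightarrow> int \<Rightarrow> int set" where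
  "col b j = {j * b..<(j + 1) * b}"

lemma col_bounds: "x \<in> col b j \<Longrightarrow> 0 \<le> x - j * b \<and> x - j * b < b"
  by (auto simp: col_def algebra_simps)

lemma mem_col_div: "0 < b \<Longrightarrow> x \<in> col b (x div b)"
  using pos_mod_bound[of b x] pos_mod_sign[of b x] div_mult_mod_eq[of x b]
  unfolding col_def atLeastLessThan_iff distrib_right by linarith

text \<open>The guard \<open>\<bar>y - x\<bar> \<le> int n\<close> keeps only pairs joined by a
  directed path, since \<open>lpp\<close> is meaningless for the others; between columns too far
  apart the event holds vacuously.\<close>

definition block_le ::
  "int \<Rightarrow> nat \<Rightarrow> int \<Rightarrow> int \<Rightarrow> int \<Rightarrow> real \<Rightarrow> (int \<times> int \<Rightarrow> real) \<Rightarrow> bool" where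
  "block_le p n b j j' t w \<longleftrightarrow> (\<forall>x\<in>col b j. \<forall>y\<in>col b j'.
     \<bar>y - x\<bar> \<le> int n \<longrightarrow> lpp w (pt p x) (pt (p + int n) y) \<le> t)"

definition Xw :: "nat \<Rightarrow> int \<Rightarrow> (int \<times> int \<Rightarrow> real) \<Rightarrow> real" where
  "Xw n z w = lpp w (1, 1) (int n - z, int n + z)"

text \<open>The assumptions restated on \<open>env\<close>. \<open>mX\<close> abstracts the mean,
  which enters only through (LS) and as the centring in the tail bounds; it can thus be instantiated
  by the expectation over the original space without transferring integrals.\<close>

locale lpp_tails = iid_field +
  fixes \<mu> \<alpha> :: real and mX :: "nat \<Rightarrow> int \<Rightarrow> real"
  assumes LS: "\<exists>\<rho>>0. \<exists>G>0. \<exists>H>0. \<exists>g1>0. \<exists>g2>0. \<exists>r0::real. \<forall>r::nat. real r > r0 \<longrightarrow>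
        (\<forall>z::int. \<bar>real_of_int z\<bar> \<le> \<rho> * real r \<longrightarrow>
          \<mu> * real r - G * real_of_int z ^ 2 / real r - H * real_of_int z ^ 4 / real r ^ 3
              - g1 * real r powr (1/3) \<le> mX r z \<and>
          mX r z \<le> \<mu> * real r - G * real_of_int z ^ 2 / real r - g2 * real r powr (1/3))"
    and alpha_pos: "\<alpha> > 0"
    and UT: "\<forall>\<epsilon>>0. \<exists>c>0. \<exists>\<theta>0>0. \<exists>r0>0. \<forall>r::nat. \<forall>\<theta>::real. \<forall>z::int.
        real r > r0 \<and> \<theta> > \<theta>0 \<and> \<bar>real_of_int z\<bar> \<le> (1 - \<epsilon>) * real r \<longrightarrow>
        pr (\<lambda>w. Xw r z w - mX r z > \<theta> * real r powr (1/3)) \<le> exp (- c * \<theta> powr \<alpha>)"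
    and LT: "\<forall>\<epsilon>>0. \<exists>c>0. \<exists>\<theta>0>0. \<exists>r0>0. \<forall>r::nat. \<forall>\<theta>::real. \<forall>z::int.
        real r > r0 \<and> \<theta> > \<theta>0 \<and> \<bar>real_of_int z\<bar> \<le> (1 - \<epsilon>) * real r \<longrightarrow>
        pr (\<lambda>w. Xw r z w - mX r z < - \<theta> * real r powr (1/3)) \<le> exp (- c * \<theta> powr \<alpha>)"
    and LB: "\<exists>\<delta>>0. \<exists>C>0. \<exists>r0::real. \<forall>r::nat. real r > r0 \<longrightarrow>
        pr (\<lambda>w. Xw r 0 w - \<mu> * real r < - C * real r powr (1/3)) \<ge> \<delta>"
begin

lemma measurable_Xw [measurable]: "Xw n z \<in> borel_measurable env"
  unfolding Xw_def[abs_def] by measurable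

lemma measurable_block_le [measurable]: "Measurable.pred env (block_le p n b j j' t)"
proof -
  have "Measurable.pred env (\<lambda>w. \<bar>y - x\<bar> \<le> int n \<longrightarrow> lpp w (pt p x) (pt (p + int n) y) \<le> t)" for x y
    by measurable
  then show ?thesis
    unfolding block_le_def[abs_def] by (intro pred_intros_finite) (auto simp: col_def)
qed

lemma pr_Xw_reflect: "pr (\<lambda>w. Xw n (- z) w < t) = pr (\<lambda>w. Xw n z w < t)"
  using pr_lpp_swap[of "\<lambda>x. x < t" "(1, 1)" "(int n - z, int n + z)"] by (simp add: Xw_def)

text \<open>Reflection: disjoint copies of \<open>X\<^sub>n\<^sup>z\<close> and \<open>X\<^sub>n\<^sup>-\<^sup>z\<close> sit inside \<open>X\<^sub>2\<^sub>n\<^sup>0\<close>,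
  so (LB) passes from the diagonal to every direction.\<close>

lemma lower_bound_all_directions:
  "\<exists>\<delta>>0. \<delta> \<le> 1 \<and> (\<exists>C>0. \<exists>r0::real. \<forall>n::nat. \<forall>z::int. real n > r0 \<and> \<bar>z\<bar> < int n \<longrightarrow>
     \<delta> \<le> pr (\<lambda>w. Xw n z w < \<mu> * real n - C * real n powr (1/3)))"
proof -
  from LB obtain \<delta> C r0 where *: "\<delta> > 0" "C > 0"
    "\<And>r::nat. real r > r0 \<Longrightarrow> pr (\<lambda>w. Xw r 0 w - \<mu> * real r < - C * real r powr (1/3)) \<ge> \<delta>"
    by blast
  have "min 1 (\<delta> / 2) \<le> pr (\<lambda>w. Xw n z w < \<mu> * real n - C / 2 * real n powr (1/3))"
    if n: "real n > r0" and z: "\<bar>z\<bar> < int n" for n z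
  proof -
    let ?t = "\<mu> * real n - C / 2 * real n powr (1/3)"
    have sum_less: "a + b \<le> x \<Longrightarrow> x < 2 * t \<Longrightarrow> a < t \<or> b < t" for a b x t :: real
      by linarith
    \<comment> \<open>The deficit at index \<open>2 * n\<close> is at least the one at
      \<open>n\<close>; sharing it between two halves leaves \<open>C / 2\<close> each.\<close>
    have half: "\<mu> * real (2 * n) - C * real (2 * n) powr (1/3) \<le> 2 * ?t"
    proof -
      have "real n powr (1/3) \<le> real (2 * n) powr (1/3)" by (intro powr_mono2) auto
      then have "C * real n powr (1/3) \<le> C * real (2 * n) powr (1/3)"
        using *(2) by (intro mult_left_mono) auto
      then show ?thesis by (simp add: algebra_simps)
    qed
    have "\<delta> \<le> pr (\<lambda>w. Xw (2 * n) 0 w - \<mu> * real (2 * n) < - C * real (2 * n) powr (1/3))"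
      using n by (intro *(3)) simp
    \<comment> \<open>If neither half were below \<open>?t\<close>, superadditivity would contradict
      the bound on \<open>Xw (2 * n) 0\<close>. By reflection both halves are equally likely to be
      low, whence \<delta> / 2.\<close>
    also have "\<dots> \<le> pr (\<lambda>w. Xw n z w < ?t \<or> lpp w (pt (int n + 1) z) (pt (2 * int n) 0) < ?t)"
    proof (rule pr_mono_nonneg)
      fix w :: "int \<times> int \<Rightarrow> real" assume w: "\<And>v. 0 \<le> w v"
        and X: "Xw (2 * n) 0 w - \<mu> * real (2 * n) < - C * real (2 * n) powr (1/3)"
      have "lpp w (pt 1 0) (pt (int n) z) + lpp w (pt (int n + 1) z) (pt (2 * int n) 0) \<le> lpp w (pt 1 0) (pt (2 * int n) 0)"
        using lpp_superadditive[of w "pt 1 0" "pt (int n) z" "pt (2 * int n) 0"] w z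
        by (simp add: pt_add_one dominated_pt)
      then have "Xw n z w + lpp w (pt (int n + 1) z) (pt (2 * int n) 0) \<le> Xw (2 * n) 0 w"
        by (simp add: Xw_def pt_def)
      moreover have "Xw (2 * n) 0 w < 2 * ?t" using X half by simp
      ultimately show "Xw n z w < ?t \<or> lpp w (pt (int n + 1) z) (pt (2 * int n) 0) < ?t"
        by (rule sum_less)
    qed measurable
    also have "\<dots> \<le> pr (\<lambda>w. Xw n z w < ?t) + pr (\<lambda>w. lpp w (pt (int n + 1) z) (pt (2 * int n) 0) < ?t)"
      by (rule pr_union) measurable
    also have "pr (\<lambda>w. lpp w (pt (int n + 1) z) (pt (2 * int n) 0) < ?t) = pr (\<lambda>w. Xw n (- z) w < ?t)"
      unfolding Xw_def by (rule pr_lpp_pt[where R = "\<lambda>x. x < ?t"]) auto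
    finally show ?thesis by (simp add: pr_Xw_reflect)
  qed
  then show ?thesis
    using *(1,2) by (intro exI[of _ "min 1 (\<delta> / 2)"] conjI exI[of _ "C / 2"] exI[of _ r0]) auto
qed

text \<open>Offsets up to \<open>s\<close> to the power 2/3 lower the mean by no more than the
  fluctuation scale, so (LT) with a large fixed deviation covers all of them. These passages are the
  connections attached to a slab.\<close>

lemma lower_tail_near_diagonal:
  assumes "0 < \<epsilon>"
  shows "\<exists>C>0. \<exists>s0>1. \<forall>s::nat. \<forall>z::int. real s > s0 \<and> \<bar>real_of_int z\<bar> \<le> (real s powr (1/3))\<^sup>2 \<longrightarrow>
    pr (\<lambda>w. Xw s z w < \<mu> * real s - C * real s powr (1/3)) \<le> \<epsilon>"
proof -
  from LS obtain \<rho> G H g1 g2 r1 where ls: "\<rho> > 0" "G > 0" "H > 0" "g1 > 0"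
    "\<forall>r::nat. real r > r1 \<longrightarrow> (\<forall>z::int. \<bar>real_of_int z\<bar> \<le> \<rho> * real r \<longrightarrow>
      \<mu> * real r - G * real_of_int z ^ 2 / real r - H * real_of_int z ^ 4 / real r ^ 3
        - g1 * real r powr (1/3) \<le> mX r z \<and>
      mX r z \<le> \<mu> * real r - G * real_of_int z ^ 2 / real r - g2 * real r powr (1/3))"
    by blast
  have half: "(0::real) < 1/2" by simp
  from LT[rule_format, OF half] obtain c \<theta>0 r2 where lt: "c > 0"
    "\<forall>r::nat. \<forall>\<theta>::real. \<forall>z::int. real r > r2 \<and> \<theta> > \<theta>0 \<and> \<bar>real_of_int z\<bar> \<le> (1 - 1/2) * real r \<longrightarrow>
        pr (\<lambda>w. Xw r z w - mX r z < - \<theta> * real r powr (1/3)) \<le> exp (- c * \<theta> powr \<alpha>)"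
    by blast
  obtain \<theta> where th: "\<theta> > max 0 \<theta>0" "exp (- c * \<theta> powr \<alpha>) \<le> \<epsilon>"
    using exp_powr_le_small[OF lt(1) alpha_pos assms] by blast
  define s0 where "s0 = Max {r1, r2, (1 / \<rho> + 2) ^ 3}"
  \<comment> \<open>Each summand of the constant pays for one loss: curvature, quartic correction,
    the \<open>g1\<close> term of (LS), and the deviation in (LT).\<close>
  have "pr (\<lambda>w. Xw s z w < \<mu> * real s - (G + H + g1 + \<theta>) * real s powr (1/3)) \<le> \<epsilon>"
    if s: "real s > s0" and z: "\<bar>real_of_int z\<bar> \<le> (real s powr (1/3))\<^sup>2" for s :: nat and z :: int
  proof -
    define \<sigma> where "\<sigma> = real s powr (1/3)"
    have sr: "real s > r1" "real s > r2" "real s > (1 / \<rho> + 2) ^ 3"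
      using s by (auto simp: s0_def)
    have s3: "real s = \<sigma> ^ 3" by (simp add: \<sigma>_def powr_third_cubed)
    have sig: "\<sigma> > 1 / \<rho> + 2"
      using sr(3) unfolding s3 by (rule power_less_imp_less_base) (simp add: \<sigma>_def)
    moreover have "0 < 1 / \<rho>" using ls(1) by simp
    ultimately have sig2: "\<sigma> > 2" and "1 / \<rho> \<le> \<sigma>" by linarith+
    then have sig3: "1 \<le> \<rho> * \<sigma>" using ls(1) by (simp add: divide_le_eq mult.commute)
    have z': "\<bar>real_of_int z\<bar> \<le> \<sigma>\<^sup>2" using z by (simp add: \<sigma>_def)
    have zr: "\<bar>real_of_int z\<bar> \<le> \<rho> * real s"
    proof -
      have "\<sigma>\<^sup>2 * 1 \<le> \<sigma>\<^sup>2 * (\<rho> * \<sigma>)" using sig3 by (intro mult_left_mono) auto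
      then show ?thesis using z' by (simp add: s3 power2_eq_square power3_eq_cube mult_ac)
    qed
    have zh: "\<bar>real_of_int z\<bar> \<le> (1 - 1/2) * real s"
    proof -
      have "\<sigma>\<^sup>2 * 2 \<le> \<sigma>\<^sup>2 * \<sigma>" using sig2 by (intro mult_left_mono) auto
      then show ?thesis using z' by (simp add: s3 power2_eq_square power3_eq_cube mult_ac)
    qed
    have "real_of_int z ^ 2 \<le> (\<sigma>\<^sup>2)\<^sup>2"
      using z' by (metis abs_ge_zero power2_abs power_mono)
    then have z2: "real_of_int z ^ 2 / real s \<le> \<sigma>"
      using sig2 by (simp add: s3 divide_le_eq power2_eq_square power3_eq_cube mult_ac)
    have "real_of_int z ^ 4 \<le> (\<sigma>\<^sup>2) ^ 4"
      using z' by (metis abs_ge_zero power_even_abs_numeral power_mono even_numeral)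
    also have "\<dots> \<le> \<sigma> * (\<sigma> ^ 3) ^ 3"
      using sig2 power_increasing[of 8 10 \<sigma>] by (simp flip: power_mult power_Suc)
    finally have z4: "real_of_int z ^ 4 / real s ^ 3 \<le> \<sigma>"
      using sig2 by (simp add: s3 divide_le_eq)
    have "G * (real_of_int z ^ 2 / real s) \<le> G * \<sigma>" "H * (real_of_int z ^ 4 / real s ^ 3) \<le> H * \<sigma>"
      using ls(2,3) z2 z4 by (intro mult_left_mono; simp)+
    then have "\<mu> * real s - (G + H + g1) * \<sigma> \<le> mX s z"
      using conjunct1[OF ls(5)[rule_format, OF sr(1) zr]] by (simp add: \<sigma>_def algebra_simps)
    then have "pr (\<lambda>w. Xw s z w < \<mu> * real s - (G + H + g1 + \<theta>) * \<sigma>)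
        \<le> pr (\<lambda>w. Xw s z w - mX s z < - \<theta> * real s powr (1/3))"
      by (intro pr_mono) (auto simp: algebra_simps \<sigma>_def)
    also have "\<dots> \<le> exp (- c * \<theta> powr \<alpha>)"
      using th(1) sr(2) zh by (intro lt(2)[rule_format] conjI) auto
    finally show ?thesis using th(2) by (simp add: \<sigma>_def)
  qed
  moreover have "s0 > 1"
  proof -
    have "1 < (1 / \<rho> + 2) ^ 3" using ls(1) by (intro one_less_power) (auto simp: add_pos_pos add_strict_increasing)
    then show ?thesis by (auto simp: s0_def less_max_iff_disj)
  qed
  moreover have "G + H + g1 + \<theta> > 0" using ls th(1) by simp
  ultimately show ?thesis by blast
qed

text \<open>All points of the two columns are tied to the same corners, at offsets
  \<open>j * b\<close> and \<open>j' * b\<close>, so a statement about all crossings becomes one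
  about a single passage time. The index \<open>n + 2 * s + 1\<close> counts \<open>s\<close>
  heights per connection and the \<open>n + 1\<close> heights of the block.\<close>

lemma block_le_sandwich:
  fixes s n :: nat and b j j' p :: int
  assumes a: "\<And>z. \<bar>z\<bar> < b \<Longrightarrow> pr (\<lambda>w. Xw s z w < a) \<le> \<epsilon>" and b: "b \<le> int s"
  shows "(1 - pr (block_le p n b j j' t)) * (1 - 2 * \<epsilon>)
    \<le> pr (\<lambda>w. t + 2 * a < Xw (n + 2 * s + 1) ((j' - j) * b) w)"
proof -
  have "1 - pr (block_le p n b j j' t) = pr (\<lambda>w. \<not> block_le p n b j j' t w)"
    by (simp add: pr_not)
  also have "(\<lambda>w. \<not> block_le p n b j j' t w) = (\<lambda>w. \<exists>x\<in>col b j. \<exists>y\<in>col b j'.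
      \<bar>y - x\<bar> \<le> (p + int n) - p \<and> t < lpp w (pt p x) (pt (p + int n) y))"
    by (auto simp: block_le_def fun_eq_iff not_le)
  finally have "(1 - pr (block_le p n b j j' t)) * (1 - 2 * \<epsilon>) = pr (\<lambda>w. \<exists>x\<in>col b j. \<exists>y\<in>col b j'.
      \<bar>y - x\<bar> \<le> (p + int n) - p \<and> t < lpp w (pt p x) (pt (p + int n) y)) * (1 - 2 * \<epsilon>)" by simp
  also have "\<dots> \<le> pr (\<lambda>w. t + 2 * a < lpp w (pt (p - int s) (j * b)) (pt (p + int n + int s) (j' * b)))"
  proof (rule sandwich)
    fix x assume x: "x \<in> col b j"
    have "pr (\<lambda>w. lpp w (pt (p - int s) (j * b)) (pt (p - 1) x) < a) = pr (\<lambda>w. Xw s (x - j * b) w < a)"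
      unfolding Xw_def by (rule pr_lpp_pt[where R = "\<lambda>x. x < a"]) auto
    also have "\<dots> \<le> \<epsilon>" using col_bounds[OF x] by (intro a) auto
    finally show "pr (\<lambda>w. lpp w (pt (p - int s) (j * b)) (pt (p - 1) x) < a) \<le> \<epsilon>" .
    show "\<bar>x - j * b\<bar> \<le> p - 1 - (p - int s)" using col_bounds[OF x] b by auto
  next
    fix y assume y: "y \<in> col b j'"
    have "pr (\<lambda>w. lpp w (pt (p + int n + 1) y) (pt (p + int n + int s) (j' * b)) < a) = pr (\<lambda>w. Xw s (j' * b - y) w < a)"
      unfolding Xw_def by (rule pr_lpp_pt[where R = "\<lambda>x. x < a"]) auto
    also have "\<dots> \<le> \<epsilon>" using col_bounds[OF y] by (intro a) auto
    finally show "pr (\<lambda>w. lpp w (pt (p + int n + 1) y) (pt (p + int n + int s) (j' * b)) < a) \<le> \<epsilon>" .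
    show "\<bar>j' * b - y\<bar> \<le> p + int n + int s - (p + int n + 1)" using col_bounds[OF y] b by auto
  qed (simp_all add: col_def)
  also have "\<dots> = pr (\<lambda>w. t + 2 * a < Xw (n + 2 * s + 1) ((j' - j) * b) w)"
    unfolding Xw_def by (rule pr_lpp_pt[where R = "\<lambda>x. t + 2 * a < x"]) (auto simp: algebra_simps)
  finally show ?thesis .
qed

lemma block_le_vacuous:
  assumes "0 < b" "int n + b \<le> \<bar>j' - j\<bar> * b"
  shows "pr (block_le p n b j j' t) = 1"
proof -
  have "int n < \<bar>y - x\<bar>" if "x \<in> col b j" "y \<in> col b j'" for x y
  proof -
    have "\<bar>j' - j\<bar> * b = \<bar>j' * b - j * b\<bar>" using assms(1) by (simp add: abs_mult flip: left_diff_distrib)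
    then show ?thesis using col_bounds[OF that(1)] col_bounds[OF that(2)] assms by linarith
  qed
  then have "block_le p n b j j' t w" for w by (force simp: block_le_def)
  then show ?thesis using E.prob_space by (simp add: pr_def)
qed

end

section \<open>The cost of a low block\<close>

text \<open>At lateral scale \<open>s\<close> to the power 2/3 the curvature loss
  \<open>G z^2 / s\<close> is of the fluctuation order, \<open>s\<close> to the power 1/3.\<close>

definition block_width :: "nat \<Rightarrow> int" where
  "block_width s = \<lfloor>(real s powr (1/3))\<^sup>2\<rfloor>"

lemma block_width_bounds:
  assumes "1 \<le> s"
  shows "1 \<le> block_width s" "real_of_int (block_width s) \<le> (real s powr (1/3))\<^sup>2"
    "(real s powr (1/3))\<^sup>2 / 2 \<le> real_of_int (block_width s)" "block_width s \<le> int s" "1 \<le> real s powr (1/3)"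
proof -
  let ?\<sigma> = "real s powr (1/3)"
  show s1: "1 \<le> ?\<sigma>" using assms by (simp add: ge_one_powr_ge_zero)
  then have s2: "1 \<le> ?\<sigma>\<^sup>2" by simp
  then show w1: "1 \<le> block_width s" by (simp add: block_width_def)
  show "real_of_int (block_width s) \<le> ?\<sigma>\<^sup>2" by (simp add: block_width_def)
  moreover have "?\<sigma>\<^sup>2 \<le> ?\<sigma> ^ 3" using s1 by (intro power_increasing) auto
  ultimately have "real_of_int (block_width s) \<le> real s" by (simp add: powr_third_cubed)
  then show "block_width s \<le> int s" by linarith
  have "?\<sigma>\<^sup>2 < real_of_int (block_width s) + 1" unfolding block_width_def by linarith
  with w1 show "?\<sigma>\<^sup>2 / 2 \<le> real_of_int (block_width s)" by linarith
qed

text \<open>An exponential lower bound for success probabilities turns the product over blocks into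
  a sum of costs.\<close>

lemma exp_minus_double_le: "0 \<le> p \<Longrightarrow> p \<le> 1 / 2 \<Longrightarrow> exp (- (2 * p)) \<le> 1 - p" for p :: real
proof -
  assume p: "0 \<le> p" "p \<le> 1 / 2"
  have "p * p \<le> p * (1 / 2)" using p by (intro mult_left_mono) auto
  then have "- (2 * p) \<le> ln (1 - p)"
    using ln_one_minus_pos_lower_bound[OF p] by (simp add: power2_eq_square)
  then have "exp (- (2 * p)) \<le> exp (ln (1 - p))" by simp
  also have "\<dots> = 1 - p" using p by simp
  finally show ?thesis .
qed

text \<open>Degree 4 matches the two inverse squares in the cost of a block; the factor 4 is the 2
  of \<open>block_upper_tail\<close> times the 2 of \<open>exp_minus_double_le\<close>.\<close>

lemma exp_powr_beats_polynomial:
  fixes c \<alpha> K :: real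
  assumes "0 < c" "0 < \<alpha>" "0 < K"
  shows "\<exists>L1. \<forall>L\<ge>L1. 4 * exp (- c * (L / K) powr \<alpha>) * (1 + L) ^ 4 \<le> 1"
proof -
  have "((\<lambda>L::real. 4 * exp (- c * (L / K) powr \<alpha>) * (1 + L) ^ 4) \<longlongrightarrow> 0) at_top"
    using assms by real_asymp
  then have "\<forall>\<^sub>F L in at_top. 4 * exp (- c * (L / K) powr \<alpha>) * (1 + L) ^ 4 < 1"
    by (rule order_tendstoD) simp
  then show ?thesis unfolding eventually_at_top_linorder by (meson less_imp_le)
qed

context lpp_tails
begin

lemma block_le_mono: "t \<le> t' \<Longrightarrow> pr (block_le p n b j j' t) \<le> pr (block_le p n b j j' t')"
  by (rule pr_mono) (auto simp: block_le_def intro: order.trans)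

text \<open>The height is a multiple \<open>m\<close> of \<open>s\<close> while the width is tuned
  to \<open>s\<close>: for large \<open>m\<close> the deficit available at height
  \<open>m * s\<close>, in every direction, exceeds what two connections of height \<open>s\<close>
  may lose.\<close>

lemma block_low_positive:
  "\<exists>m::nat. 1 \<le> m \<and> (\<exists>\<delta>>0. \<delta> \<le> 1 \<and> (\<exists>s0>1. \<forall>s::nat. \<forall>p j j'. real s > s0 \<longrightarrow>
     \<delta> \<le> pr (block_le p (m * s) (block_width s) j j' (\<mu> * real (m * s) - real s powr (1/3)))))"
proof -
  obtain \<delta> C r0 where lb: "\<delta> > 0" "\<delta> \<le> 1" "C > 0"
    "\<forall>n::nat. \<forall>z::int. real n > r0 \<and> \<bar>z\<bar> < int n \<longrightarrow>
     \<delta> \<le> pr (\<lambda>w. Xw n z w < \<mu> * real n - C * real n powr (1/3))"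
    using lower_bound_all_directions by blast
  \<comment> \<open>Failure probability \<delta> / 4 per connection yields the factor
    \<open>1 - \<delta> / 2\<close> in the sandwich, and
    \<open>1 - \<delta> < (1 - \<delta> / 2)^2\<close> then leaves probability \<delta> / 2 for the
    low block.\<close>
  have "0 < \<delta> / 4" using lb(1) by simp
  from lower_tail_near_diagonal[OF this] obtain C' s1 where lt: "C' > 0" "s1 > 1"
    "\<forall>s::nat. \<forall>z::int. real s > s1 \<and> \<bar>real_of_int z\<bar> \<le> (real s powr (1/3))\<^sup>2 \<longrightarrow>
      pr (\<lambda>w. Xw s z w < \<mu> * real s - C' * real s powr (1/3)) \<le> \<delta> / 4"
    by blast
  \<comment> \<open>\<open>2 * C'\<close> pays for the two connections,
    \<open>\<bar>\<mu>\<bar>\<close> for the extra unit in \<open>N\<close>, and 1 is the deficit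
    kept in the conclusion. \<open>m\<close> is at least the cube of \<open>B\<close> because the
    gain scales like a cube root.\<close>
  define B where "B = (2 * C' + \<bar>\<mu>\<bar> + 1) / C"
  have B: "B > 0" using lb(3) lt(1) by (simp add: B_def add_pos_nonneg)
  obtain m :: nat where m: "B ^ 3 \<le> real m" using real_arch_simple by blast
  have m1: "1 \<le> m" using m B zero_less_power[OF B, of 3] by (cases m) auto
  have mB: "B \<le> real m powr (1/3)"
  proof -
    have "B ^ 3 \<le> (real m powr (1/3)) ^ 3" using m by (simp add: powr_third_cubed)
    then show ?thesis using power_le_imp_le_base[of B 2 "real m powr (1/3)"] by (simp add: numeral_3_eq_3)
  qed
  have "\<delta> / 2 \<le> pr (block_le p (m * s) (block_width s) j j' (\<mu> * real (m * s) - real s powr (1/3)))"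
    if s: "real s > max s1 r0" for s :: nat and p j j'
  proof -
    define \<sigma> where "\<sigma> = real s powr (1/3)"
    define t where "t = \<mu> * real (m * s) - \<sigma>"
    define a where "a = \<mu> * real s - C' * \<sigma>"
    define N where "N = m * s + 2 * s + 1"
    have s1: "1 \<le> s" using s lt(2) by simp
    note w = block_width_bounds[OF s1, folded \<sigma>_def]
    show ?thesis
    proof (cases "int (m * s) + block_width s \<le> \<bar>j' - j\<bar> * block_width s")
      case True
      then show ?thesis using block_le_vacuous[of "block_width s" "m * s" j' j] w(1) lb(2) by simp
    next
      case False
      define z where "z = (j' - j) * block_width s"
      have z: "\<bar>z\<bar> < int N" using False w(1,4) by (simp add: z_def N_def abs_mult)
      have Nr: "real N > r0"
      proof -
        have "real s \<le> real N" by (simp add: N_def)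
        then show ?thesis using s by simp
      qed
      have ta: "\<mu> * real N - C * real N powr (1/3) \<le> t + 2 * a"
      proof -
        have "(2 * C' + \<bar>\<mu>\<bar> + 1) * \<sigma> = C * (B * \<sigma>)" using lb(3) by (simp add: B_def)
        also have "\<dots> \<le> C * (real m powr (1/3) * \<sigma>)"
          using lb(3) mB w(5) by (intro mult_left_mono mult_right_mono) auto
        also have "real m powr (1/3) * \<sigma> = real (m * s) powr (1/3)"
          by (simp add: \<sigma>_def powr_mult)
        also have "C * real (m * s) powr (1/3) \<le> C * real N powr (1/3)"
          using lb(3) by (intro mult_left_mono powr_mono2) (auto simp: N_def)
        finally have 1: "(2 * C' + \<bar>\<mu>\<bar> + 1) * \<sigma> \<le> C * real N powr (1/3)" .
        have "\<mu> \<le> \<bar>\<mu>\<bar> * \<sigma>"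
          using w(5) mult_left_mono[of 1 \<sigma> "\<bar>\<mu>\<bar>"] by simp
        with 1 show ?thesis by (simp add: N_def t_def a_def algebra_simps)
      qed
      have low: "pr (\<lambda>w. Xw s x w < a) \<le> \<delta> / 4" if "\<bar>x\<bar> < block_width s" for x
      proof -
        have "\<bar>real_of_int x\<bar> \<le> \<sigma>\<^sup>2" using that w(2) by linarith
        then show ?thesis using lt(3) s by (simp add: a_def \<sigma>_def)
      qed
      have "(1 - pr (block_le p (m * s) (block_width s) j j' t)) * (1 - 2 * (\<delta> / 4))
          \<le> pr (\<lambda>w. t + 2 * a < Xw N z w)"
        unfolding N_def z_def by (rule block_le_sandwich[OF low w(4)])
      also have "\<dots> \<le> pr (\<lambda>w. \<not> (Xw N z w < \<mu> * real N - C * real N powr (1/3)))"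
        using ta by (intro pr_mono) auto
      also have "\<dots> = 1 - pr (\<lambda>w. Xw N z w < \<mu> * real N - C * real N powr (1/3))"
        by (rule pr_not) measurable
      also have "\<dots> \<le> 1 - \<delta>" using lb(4) z Nr by simp
      finally have 1: "(1 - pr (block_le p (m * s) (block_width s) j j' t)) * (1 - \<delta> / 2) \<le> 1 - \<delta>" by simp
      show ?thesis
      proof (rule ccontr)
        assume "\<not> ?thesis"
        then have "1 - \<delta> / 2 < 1 - pr (block_le p (m * s) (block_width s) j j' t)"
          by (simp add: t_def \<sigma>_def)
        then have "(1 - \<delta> / 2) * (1 - \<delta> / 2) \<le> (1 - pr (block_le p (m * s) (block_width s) j j' t)) * (1 - \<delta> / 2)"
          using lb(2) by (intro mult_right_mono) auto
        with 1 have "(1 - \<delta> / 2) * (1 - \<delta> / 2) \<le> 1 - \<delta>" by linarith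
        then have "\<delta> * \<delta> \<le> 0" by (simp add: algebra_simps)
        then show False using lb(1) by (simp add: mult_le_0_iff)
      qed
    qed
  qed
  then show ?thesis
    using m1 lb(1,2) lt(2)
    by (intro exI[of _ m] conjI exI[of _ "\<delta> / 2"] exI[of _ "max s1 r0"]) auto
qed

text \<open>(UT) is applied to one passage from corner to corner, and the quadratic term is the
  curvature in (LS). Blocks between distant columns may be crossed in nearly axial directions;
  connections of height \<open>M * s\<close> bring the overall direction into the range of (LS) and
  (UT). The factor 2 arises because each connection may fail with probability 1/4.\<close>

lemma block_upper_tail:
  assumes m: "1 \<le> m"
  shows "\<exists>c>0. \<exists>K>0. \<exists>K'>0. \<exists>G>0. \<exists>\<theta>0>0. \<exists>s0>1. \<forall>s::nat. \<forall>\<theta> p j j'. real s > s0 \<and> \<theta> > \<theta>0 \<longrightarrow>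
     1 - pr (block_le p (m * s) (block_width s) j j' (\<mu> * real (m * s)
        + real s powr (1/3) * (K + K' * \<theta> - G * (real_of_int (j' - j))\<^sup>2)))
     \<le> 2 * exp (- c * \<theta> powr \<alpha>)"
proof -
  from LS obtain \<rho> G H g1 g2 r1 where ls: "\<rho> > 0" "G > 0" "g2 > 0"
    "\<forall>r::nat. real r > r1 \<longrightarrow> (\<forall>z::int. \<bar>real_of_int z\<bar> \<le> \<rho> * real r \<longrightarrow>
      \<mu> * real r - G * real_of_int z ^ 2 / real r - H * real_of_int z ^ 4 / real r ^ 3
        - g1 * real r powr (1/3) \<le> mX r z \<and>
      mX r z \<le> \<mu> * real r - G * real_of_int z ^ 2 / real r - g2 * real r powr (1/3))"
    by blast
  have half: "(0::real) < 1/2" and quarter: "(0::real) < 1/4" by simp_all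
  from UT[rule_format, OF half] obtain c \<theta>0 r2 where ut: "c > 0" "\<theta>0 > 0"
    "\<forall>r::nat. \<forall>\<theta>::real. \<forall>z::int. real r > r2 \<and> \<theta> > \<theta>0 \<and> \<bar>real_of_int z\<bar> \<le> (1 - 1/2) * real r \<longrightarrow>
        pr (\<lambda>w. Xw r z w - mX r z > \<theta> * real r powr (1/3)) \<le> exp (- c * \<theta> powr \<alpha>)"
    by blast
  from lower_tail_near_diagonal[OF quarter] obtain C' s1 where lt: "C' > 0" "s1 > 1"
    "\<forall>s::nat. \<forall>z::int. real s > s1 \<and> \<bar>real_of_int z\<bar> \<le> (real s powr (1/3))\<^sup>2 \<longrightarrow>
      pr (\<lambda>w. Xw s z w < \<mu> * real s - C' * real s powr (1/3)) \<le> 1 / 4"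
    by blast
  \<comment> \<open>\<rho> is the range of (LS) and 1/2 that of (UT). A block that is not vacuous
    has offset at most \<open>(m + 1) * s\<close>, hence the choice of \<open>M\<close> with
    \<open>m + 1 \<le> \<kappa> * M\<close>.\<close>
  define \<kappa> where "\<kappa> = min \<rho> (1/2)"
  have kap: "\<kappa> > 0" "\<kappa> \<le> \<rho>" "\<kappa> \<le> 1/2" using ls(1) by (auto simp: \<kappa>_def)
  obtain M :: nat where M0: "(real m + 1) / \<kappa> \<le> real M" using real_arch_simple by blast
  have M: "real m + 1 \<le> \<kappa> * real M" using M0 kap(1) by (simp add: divide_le_eq mult.commute)
  have M1: "1 \<le> M" using M kap(1) by (cases M) auto
  define Q where "Q = real (m + 2 * M + 1)"
  have Q1: "Q \<ge> 1" by (simp add: Q_def)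
  define K where "K = \<bar>\<mu>\<bar> + 2 * C' * real M"
  \<comment> \<open>The width is at least half of \<open>s\<close> to the power 2/3, which costs a
    factor 4 after squaring, and \<open>N\<close> is at most \<open>Q * s\<close>.\<close>
  define G' where "G' = G / (4 * Q)"
  define s0 where "s0 = max s1 (max r1 r2)"
  have main: "1 - pr (block_le p (m * s) (block_width s) j j' (\<mu> * real (m * s)
        + real s powr (1/3) * (K + Q * \<theta> - G' * (real_of_int (j' - j))\<^sup>2)))
     \<le> 2 * exp (- c * \<theta> powr \<alpha>)"
    if s: "real s > s0" and th: "\<theta> > \<theta>0" for s :: nat and \<theta> p j j'
  proof -
    define \<sigma> where "\<sigma> = real s powr (1/3)"
    define d where "d = real_of_int (j' - j)"
    define t where "t = \<mu> * real (m * s) + \<sigma> * (K + Q * \<theta> - G' * d\<^sup>2)"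
    define S where "S = M * s"
    define a where "a = \<mu> * real S - C' * real S powr (1/3)"
    define N where "N = m * s + 2 * S + 1"
    have s1: "1 \<le> s" using s lt(2) by (simp add: s0_def)
    note w = block_width_bounds[OF s1, folded \<sigma>_def]
    have s3: "real s = \<sigma> ^ 3" by (simp add: \<sigma>_def powr_third_cubed)
    have sS: "s \<le> S" using M1 by (simp add: S_def)
    have "s \<le> N" unfolding N_def using sS by linarith
    then have sN: "real s \<le> real N" by simp
    have N0: "real N > 0" using sN s1 by linarith
    have NQ: "real N \<le> Q * real s" using s1 by (simp add: N_def Q_def S_def algebra_simps)
    show ?thesis
    proof (cases "int (m * s) + block_width s \<le> \<bar>j' - j\<bar> * block_width s")
      case True
      then show ?thesis using block_le_vacuous[of "block_width s" "m * s" j' j] w(1) by simp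
    next
      case False
      define z where "z = (j' - j) * block_width s"
      have "\<bar>z\<bar> \<le> int (m * s) + block_width s" using False w(1) by (simp add: z_def abs_mult)
      then have "\<bar>z\<bar> \<le> int (m * s + s)" using w(4) by simp
      then have "\<bar>real_of_int z\<bar> \<le> real (m * s + s)" by linarith
      also have "\<dots> = (real m + 1) * real s" by (simp add: algebra_simps)
      also have "\<dots> \<le> \<kappa> * real M * real s" using M by (intro mult_right_mono) auto
      also have "\<dots> \<le> \<kappa> * real N"
        using kap(1) by (simp add: N_def S_def algebra_simps)
      finally have z: "\<bar>real_of_int z\<bar> \<le> \<kappa> * real N" .
      have zr: "\<bar>real_of_int z\<bar> \<le> \<rho> * real N" "\<bar>real_of_int z\<bar> \<le> (1 - 1/2) * real N"
        using z mult_right_mono[OF kap(2), of "real N"] mult_right_mono[OF kap(3), of "real N"]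
        by simp_all
      have zN: "d\<^sup>2 * \<sigma> / (4 * Q) \<le> (real_of_int z)\<^sup>2 / real N"
      proof -
        have "d\<^sup>2 * (\<sigma>\<^sup>2 / 2)\<^sup>2 \<le> d\<^sup>2 * (real_of_int (block_width s))\<^sup>2"
          using w(3) by (intro mult_left_mono power_mono) auto
        also have "\<dots> = (real_of_int z)\<^sup>2" by (simp add: z_def d_def power_mult_distrib)
        finally have 1: "d\<^sup>2 * (\<sigma>\<^sup>2 / 2)\<^sup>2 \<le> (real_of_int z)\<^sup>2" .
        have "d\<^sup>2 * \<sigma> / (4 * Q) = d\<^sup>2 * (\<sigma>\<^sup>2 / 2)\<^sup>2 / (Q * real s)"
          using Q1 w(5) by (simp add: s3 field_simps power2_eq_square power3_eq_cube)
        also have "\<dots> \<le> (real_of_int z)\<^sup>2 / (Q * real s)"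
          using 1 Q1 by (intro divide_right_mono) auto
        also have "\<dots> \<le> (real_of_int z)\<^sup>2 / real N"
          using NQ N0 by (intro divide_left_mono) auto
        finally show ?thesis .
      qed
      have powr_mult_le: "(real l * real s) powr (1/3) \<le> real l * \<sigma>" if "l \<ge> 1" for l :: nat
      proof -
        have "real l powr (1/3) \<le> real l powr 1" using that by (intro powr_mono) auto
        then show ?thesis using that w(5) by (simp add: powr_mult \<sigma>_def mult_right_mono)
      qed
      have NQ3: "real N powr (1/3) \<le> Q * \<sigma>"
      proof -
        have "real N powr (1/3) \<le> (Q * real s) powr (1/3)" using NQ by (intro powr_mono2) auto
        also have "\<dots> \<le> Q * \<sigma>" unfolding Q_def by (rule powr_mult_le) simp
        finally show ?thesis .
      qed
      have S3: "real S powr (1/3) \<le> real M * \<sigma>" using powr_mult_le[OF M1] by (simp add: S_def)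
      have "mX N z \<le> \<mu> * real N - G * (real_of_int z)\<^sup>2 / real N - g2 * real N powr (1/3)"
        using zr(1) s sN by (intro conjunct2[OF ls(4)[rule_format]]) (auto simp: s0_def)
      moreover have "0 \<le> g2 * real N powr (1/3)" using ls(3) by simp
      moreover have "G' * d\<^sup>2 * \<sigma> \<le> G * (real_of_int z)\<^sup>2 / real N"
        using mult_left_mono[OF zN, of G] ls(2) by (simp add: G'_def mult_ac)
      ultimately have mXle: "mX N z \<le> \<mu> * real N - G' * d\<^sup>2 * \<sigma>" by linarith
      have ta: "mX N z + \<theta> * real N powr (1/3) \<le> t + 2 * a"
      proof -
        have 1: "\<theta> * real N powr (1/3) \<le> \<theta> * (Q * \<sigma>)" using NQ3 th ut(2) by (intro mult_left_mono) auto
        have 2: "2 * C' * real S powr (1/3) \<le> 2 * C' * (real M * \<sigma>)"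
          using S3 lt(1) by (intro mult_left_mono) auto
        have 3: "\<mu> \<le> \<bar>\<mu>\<bar> * \<sigma>" using w(5) mult_left_mono[of 1 \<sigma> "\<bar>\<mu>\<bar>"] by simp
        have "t + 2 * a = \<mu> * real N - \<mu> + \<bar>\<mu>\<bar> * \<sigma> + 2 * C' * (real M * \<sigma>) + \<theta> * (Q * \<sigma>) - G' * d\<^sup>2 * \<sigma>
            - 2 * C' * real S powr (1/3)"
          by (simp add: t_def a_def N_def K_def algebra_simps)
        then show ?thesis using 1 2 3 mXle by linarith
      qed
      have low: "pr (\<lambda>w. Xw S x w < a) \<le> 1 / 4" if "\<bar>x\<bar> < block_width s" for x
      proof -
        have "\<sigma> \<le> real S powr (1/3)" unfolding \<sigma>_def using sS by (intro powr_mono2) auto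
        then have "\<sigma>\<^sup>2 \<le> (real S powr (1/3))\<^sup>2" using w(5) by (intro power_mono) auto
        then have "\<bar>real_of_int x\<bar> \<le> (real S powr (1/3))\<^sup>2" using that w(2) by linarith
        then show ?thesis using lt(3) s sS by (simp add: a_def s0_def)
      qed
      have "(1 - pr (block_le p (m * s) (block_width s) j j' t)) * (1 - 2 * (1 / 4))
          \<le> pr (\<lambda>w. t + 2 * a < Xw N z w)"
        unfolding N_def z_def by (rule block_le_sandwich[OF low]) (use w(4) sS in auto)
      also have "\<dots> \<le> pr (\<lambda>w. Xw N z w - mX N z > \<theta> * real N powr (1/3))"
        using ta by (intro pr_mono) auto
      also have "\<dots> \<le> exp (- c * \<theta> powr \<alpha>)"
        using th zr(2) s sN by (intro ut(3)[rule_format] conjI) (auto simp: s0_def)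
      finally show ?thesis by (simp add: t_def \<sigma>_def d_def)
    qed
  qed
  have K: "K > 0" using lt(1) M1 by (simp add: K_def add_nonneg_pos)
  have G': "G' > 0" and Q0: "Q > 0" using ls(2) Q1 by (simp_all add: G'_def)
  have s0: "s0 > 1" using lt(2) by (simp add: s0_def)
  show ?thesis
    by (rule exI[of _ c], rule conjI[OF ut(1)], rule exI[of _ K], rule conjI[OF K],
        rule exI[of _ Q], rule conjI[OF Q0], rule exI[of _ G'], rule conjI[OF G'],
        rule exI[of _ \<theta>0], rule conjI[OF ut(2)], rule exI[of _ s0], rule conjI[OF s0])
      (use main in simp)
qed

text \<open>Two regimes, separated by the size of a quantity \<open>L\<close> that grows with both
  \<open>|j' - j|\<close> and \<open>|j| / k\<close>. For large \<open>L\<close> the level lies far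
  above typical crossings and the block fails with probability at most a multiple of
  \<open>1 / (1 + L)^4\<close>; for bounded \<open>L\<close> both parameters are bounded and the
  uniform bound \<delta> suffices.\<close>

lemma block_cost:
  "\<exists>m::nat. 1 \<le> m \<and> (\<exists>g>0. \<exists>A>0. \<exists>s0>1. \<forall>s k::nat. \<forall>p j j'. real s > s0 \<and> 1 \<le> k \<longrightarrow>
     exp (- (A / ((1 + \<bar>real_of_int (j' - j)\<bar>)\<^sup>2 * (1 + \<bar>real_of_int j\<bar> / real k)\<^sup>2)))
     \<le> pr (block_le p (m * s) (block_width s) j j' (\<mu> * real (m * s) + real s powr (1/3) *
         (- 1/2 - g * \<bar>real_of_int (j' - j)\<bar> + 2 * g * \<bar>real_of_int j\<bar> / real k))))"
proof -
  obtain m \<delta> s1 where low: "1 \<le> m" "\<delta> > 0" "\<delta> \<le> 1" "s1 > 1"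
    "\<forall>s::nat. \<forall>p j j'. real s > s1 \<longrightarrow>
     \<delta> \<le> pr (block_le p (m * s) (block_width s) j j' (\<mu> * real (m * s) - real s powr (1/3)))"
    using block_low_positive by blast
  obtain c K K' G \<theta>0 s2 where up: "c > 0" "K > 0" "K' > 0" "G > 0" "\<theta>0 > 0" "s2 > 1"
    "\<forall>s::nat. \<forall>\<theta> p j j'. real s > s2 \<and> \<theta> > \<theta>0 \<longrightarrow>
     1 - pr (block_le p (m * s) (block_width s) j j' (\<mu> * real (m * s)
        + real s powr (1/3) * (K + K' * \<theta> - G * (real_of_int (j' - j))\<^sup>2)))
     \<le> 2 * exp (- c * \<theta> powr \<alpha>)"
    using block_upper_tail[OF low(1)] by blast
  have "0 < 2 * K'" using up(3) by simp
  from exp_powr_beats_polynomial[OF up(1) alpha_pos this] obtain L1 where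
    L1: "\<forall>L\<ge>L1. 4 * exp (- c * (L / (2 * K')) powr \<alpha>) * (1 + L) ^ 4 \<le> 1" by blast
  \<comment> \<open>The constant in \<open>d \<le> G / 2 * d^2 + J\<close>, from completing the
    square: curvature pays for a term linear in the distance.\<close>
  define J where "J = 1 / (2 * G)"
  have J: "J > 0" using up(4) by (simp add: J_def)
  \<comment> \<open>\<open>L1\<close> serves the polynomial bound; the third entry lets
    \<open>L / 2\<close> absorb \<open>K + 1/2 + J\<close>; the fourth makes
    \<open>L / (2 * K')\<close> exceed the threshold of the upper tail.\<close>
  define L0 where "L0 = Max {1, L1, 2 * (K + 1/2 + J), 2 * K' * \<theta>0 + 1}"
  have L0: "L0 \<ge> 1" "L0 \<ge> L1" "L0 \<ge> 2 * (K + 1/2 + J)" "L0 \<ge> 2 * K' * \<theta>0 + 1"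
    by (auto simp: L0_def)
  define D where "D = L0 + J"
  have D: "D > 0" using L0(1) J by (simp add: D_def)
  \<comment> \<open>Small enough that \<open>g * d \<le> 1/2\<close> while \<open>d \<le> D\<close>:
    in the bounded regime the level then stays above the -1 that \<delta> covers.\<close>
  define g where "g = min 1 (1 / (2 * D))"
  have g: "g > 0" "g \<le> 1" "g * D \<le> 1/2"
  proof -
    have "g * D \<le> 1 / (2 * D) * D" using D by (intro mult_right_mono) (auto simp: g_def)
    then show "g * D \<le> 1/2" using D by simp
  qed (use D in \<open>auto simp: g_def\<close>)
  define B where "B = (1 + J)\<^sup>2 * (1 + 1 / (2 * g))\<^sup>2"
  define B' where "B' = (1 + D)\<^sup>2 * (1 + L0 / (2 * g))\<^sup>2"
  \<comment> \<open>\<open>B\<close> serves large \<open>L\<close>; the other summand serves bounded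
    \<open>L\<close>, where \<open>B'\<close> bounds the denominator.\<close>
  define A where "A = B + (- ln \<delta>) * B'"
  have B: "B > 0" using J g(1) by (auto simp: B_def intro!: mult_pos_pos add_pos_pos zero_less_power)
  have lnd: "- ln \<delta> \<ge> 0" using low(2,3) by simp
  have B': "B' \<ge> 0" by (simp add: B'_def)
  have A: "A \<ge> B" "A \<ge> (- ln \<delta>) * B'" using mult_nonneg_nonneg[OF lnd B'] B by (auto simp: A_def)
  have main: "exp (- (A / ((1 + \<bar>real_of_int (j' - j)\<bar>)\<^sup>2 * (1 + \<bar>real_of_int j\<bar> / real k)\<^sup>2)))
     \<le> pr (block_le p (m * s) (block_width s) j j' (\<mu> * real (m * s) + real s powr (1/3) *
         (- 1/2 - g * \<bar>real_of_int (j' - j)\<bar> + 2 * g * \<bar>real_of_int j\<bar> / real k)))"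
    if s: "real s > max s1 s2" and k: "1 \<le> k" for s k :: nat and p j j'
  proof -
    define d where "d = \<bar>real_of_int (j' - j)\<bar>"
    define f where "f = \<bar>real_of_int j\<bar> / real k"
    define \<sigma> where "\<sigma> = real s powr (1/3)"
    define \<tau> where "\<tau> = - 1/2 - g * d + 2 * g * f"
    define Y where "Y = (1 + d)\<^sup>2 * (1 + f)\<^sup>2"
    define L where "L = G / 2 * d\<^sup>2 + 2 * g * f"
    have d: "d \<ge> 0" and f: "f \<ge> 0" by (auto simp: d_def f_def)
    have Y: "Y > 0" using d f by (auto simp: Y_def intro!: mult_pos_pos)
    have sig: "\<sigma> \<ge> 0" by (simp add: \<sigma>_def)
    have gf: "0 \<le> g * f" using g f by simp
    have dJ: "d \<le> G / 2 * d\<^sup>2 + J"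
    proof -
      have "0 \<le> (G * d - 1)\<^sup>2 / (2 * G)" using up(4) by simp
      also have "\<dots> = G / 2 * d\<^sup>2 + J - d"
        using up(4) by (simp add: J_def field_simps power2_eq_square)
      finally show ?thesis by simp
    qed
    have L0': "0 \<le> L"
      using up(4) g(1) f unfolding L_def by (intro add_nonneg_nonneg mult_nonneg_nonneg) auto
    have dL: "d \<le> L + J" using dJ gf by (simp add: L_def)
    have fL: "f \<le> L / (2 * g)" using up(4) g(1) by (simp add: L_def field_simps)
    have "exp (- (A / Y)) \<le> pr (block_le p (m * s) (block_width s) j j' (\<mu> * real (m * s) + \<sigma> * \<tau>))"
    proof (cases "L0 \<le> L")
      case True
      \<comment> \<open>Half of \<open>L\<close> is spent on the deviation
        \<open>K' * \<theta>\<close>; the other half absorbs the constants.\<close>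
      define \<theta> where "\<theta> = L / (2 * K')"
      define q where "q = 2 * exp (- c * \<theta> powr \<alpha>)"
      have "2 * K' * \<theta>0 < L" using L0(4) True by linarith
      then have th: "\<theta> > \<theta>0" using up(3) by (simp add: \<theta>_def field_simps)
      have "2 * q * (1 + L) ^ 4 \<le> 1"
        using L1[rule_format, of L] True L0(2) by (simp add: q_def \<theta>_def)
      then have q4: "2 * q \<le> 1 / (1 + L) ^ 4" using L0' by (simp add: le_divide_eq)
      also have "1 / (1 + L) ^ 4 \<le> 1" using L0' by simp
      finally have q: "0 \<le> q" "q \<le> 1/2" by (auto simp: q_def)
      have "K + K' * \<theta> - G * (real_of_int (j' - j))\<^sup>2 \<le> \<tau>"
      proof -
        have lin: "\<lbrakk>u \<le> d'; kt = L / 2; x = 2 * e; d' \<le> e + J; L = e + h\<rbrakk> \<Longrightarrow>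
            K + kt - x \<le> - 1/2 - u + h" for u d' kt x e h
          using True L0(3) by simp
        have "g * d \<le> d" using mult_right_mono[OF g(2) d] by simp
        moreover have "K' * \<theta> = L / 2" using up(3) by (simp add: \<theta>_def)
        moreover have "G * (real_of_int (j' - j))\<^sup>2 = 2 * (G / 2 * d\<^sup>2)" by (simp add: d_def)
        ultimately show ?thesis unfolding \<tau>_def using dJ L_def by (rule lin)
      qed
      then have "\<mu> * real (m * s) + \<sigma> * (K + K' * \<theta> - G * (real_of_int (j' - j))\<^sup>2)
          \<le> \<mu> * real (m * s) + \<sigma> * \<tau>" using sig by (intro add_left_mono mult_left_mono)
      from block_le_mono[OF this, of p "m * s" "block_width s" j j']
      have "1 - q \<le> pr (block_le p (m * s) (block_width s) j j' (\<mu> * real (m * s) + \<sigma> * \<tau>))"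
        using up(7)[rule_format, of s \<theta> p j j'] s th by (simp add: q_def \<sigma>_def)
      moreover have "exp (- (A / Y)) \<le> exp (- (2 * q))"
      proof -
        \<comment> \<open>Both \<open>d\<close> and \<open>f\<close> grow at most linearly in
          \<open>L\<close>, so their four factors in \<open>Y\<close> are controlled by
          \<open>(1 + L) ^ 4\<close>.\<close>
        have "Y \<le> ((1 + J) * (1 + L))\<^sup>2 * ((1 + 1 / (2 * g)) * (1 + L))\<^sup>2"
          unfolding Y_def
        proof (intro mult_mono power_mono)
          show "1 + d \<le> (1 + J) * (1 + L)"
          proof -
            have "(1 + J) * (1 + L) = 1 + J + L + J * L" by (simp add: algebra_simps)
            then show ?thesis using dL J L0' mult_nonneg_nonneg[of J L] by linarith
          qed
          have u: "0 \<le> 1 / (2 * g)" using g(1) by simp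
          have "(1 + 1 / (2 * g)) * (1 + L) = 1 + 1 / (2 * g) + L + L / (2 * g)"
            by (simp add: algebra_simps add_divide_distrib)
          then show "1 + f \<le> (1 + 1 / (2 * g)) * (1 + L)" using fL L0' u by linarith
        qed (use d f in auto)
        also have "\<dots> = B * (1 + L) ^ 4"
          by (simp add: B_def power_mult_distrib power2_eq_square power4_eq_xxxx)
        finally have "1 / (1 + L) ^ 4 \<le> B / Y"
          using Y L0' by (simp add: field_simps)
        also have "\<dots> \<le> A / Y" using A(1) Y by (intro divide_right_mono) auto
        finally show ?thesis using q4 by simp
      qed
      ultimately show ?thesis using exp_minus_double_le[OF q] by linarith
    next
      case False
      have dD: "d \<le> D" using dL False by (simp add: D_def)
      have fD: "f \<le> L0 / (2 * g)"
        using fL False g(1) divide_right_mono[of L L0 "2 * g"] by simp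
      have "Y \<le> B'"
        unfolding Y_def B'_def using dD fD d f D by (intro mult_mono power_mono) auto
      then have "(- ln \<delta>) * Y \<le> A" using A(2) mult_left_mono[OF _ lnd, of Y B'] by linarith
      then have "- ln \<delta> \<le> A / Y" using Y by (simp add: le_divide_eq)
      then have "exp (- (A / Y)) \<le> exp (ln \<delta>)" by simp
      also have "\<dots> = \<delta>" using low(2) by simp
      also have "\<delta> \<le> pr (block_le p (m * s) (block_width s) j j' (\<mu> * real (m * s) - \<sigma>))"
        using low(5) s by (simp add: \<sigma>_def)
      also have "\<dots> \<le> pr (block_le p (m * s) (block_width s) j j' (\<mu> * real (m * s) + \<sigma> * \<tau>))"
      proof (rule block_le_mono)
        have "g * d \<le> g * D" using dD g(1) by (intro mult_left_mono) auto
        then have "- 1 \<le> \<tau>" using g(3) gf by (simp add: \<tau>_def)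
        from mult_left_mono[OF this sig]
        show "\<mu> * real (m * s) - \<sigma> \<le> \<mu> * real (m * s) + \<sigma> * \<tau>" by simp
      qed
      finally show ?thesis .
    qed
    then show ?thesis by (simp add: Y_def \<tau>_def d_def f_def \<sigma>_def)
  qed
  have A0: "A > 0" using A(1) B by simp
  have s0: "max s1 s2 > 1" using low(4) by simp
  show ?thesis
    by (rule exI[of _ m], rule conjI[OF low(1)], rule exI[of _ g], rule conjI[OF g(1)],
        rule exI[of _ A], rule conjI[OF A0], rule exI[of _ "max s1 s2"], rule conjI[OF s0])
      (use main in simp)
qed

end

section \<open>Assembling the blocks\<close>

text \<open>Cutting at the heights \<open>1 + a * n\<close> records only the offsets
  \<open>y a\<close> of the crossings. The shift by one is there because \<open>pt 1 0\<close> is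
  the site \<open>(1, 1)\<close>.\<close>

lemma lpp_chain:
  assumes w: "\<And>v. 0 \<le> w v" and "\<bar>x\<bar> \<le> int (Suc k * n)"
  shows "\<exists>y. y 0 = 0 \<and> y (Suc k) = x \<and> (\<forall>a\<le>k. \<bar>y (Suc a) - y a\<bar> \<le> int n) \<and>
    lpp w (pt 1 0) (pt (1 + int (Suc k * n)) x)
      \<le> (\<Sum>a\<le>k. lpp w (pt (1 + int (a * n)) (y a)) (pt (1 + int (a * n) + int n) (y (Suc a))))"
  using assms(2)
proof (induction k arbitrary: x)
  case 0
  show ?case
    by (rule exI[of _ "\<lambda>a. if a = 0 then 0 else x"]) (use 0 in simp)
next
  case (Suc k)
  let ?P = "1 + int (Suc k * n)"
  have P': "1 + int (Suc (Suc k) * n) = ?P + int n" by simp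
  have "dominated (pt 1 0) (pt (1 + int (Suc (Suc k) * n)) x)"
    using Suc.prems by (simp add: dominated_pt)
  then obtain c where c: "dominated (pt 1 0) c" "dominated c (pt (?P + int n) x)" "fst c + snd c = 2 * ?P"
    "lpp w (pt 1 0) (pt (?P + int n) x) \<le> lpp w (pt 1 0) c + lpp w c (pt (?P + int n) x)"
    unfolding P' by (rule lpp_split_antidiagonal[OF w, where L = "2 * ?P"]) (auto simp: pt_def)
  define x' where "x' = snd c - ?P"
  have cx: "c = pt ?P x'" using c(3) by (simp add: pt_def x'_def prod_eq_iff)
  have x': "\<bar>x'\<bar> \<le> int (Suc k * n)" "\<bar>x - x'\<bar> \<le> int n"
    using c(1,2) unfolding cx dominated_pt by simp_all
  from Suc.IH[OF x'(1)] obtain y where y: "y 0 = 0" "y (Suc k) = x'" "\<forall>a\<le>k. \<bar>y (Suc a) - y a\<bar> \<le> int n"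
    "lpp w (pt 1 0) (pt ?P x')
      \<le> (\<Sum>a\<le>k. lpp w (pt (1 + int (a * n)) (y a)) (pt (1 + int (a * n) + int n) (y (Suc a))))"
    by blast
  define y' where "y' = y(Suc (Suc k) := x)"
  have y'a: "y' a = y a" if "a \<le> Suc k" for a using that by (simp add: y'_def)
  have "lpp w (pt 1 0) (pt (1 + int (Suc (Suc k) * n)) x)
      \<le> lpp w (pt 1 0) (pt ?P x') + lpp w (pt ?P x') (pt (?P + int n) x)"
    using c(4) unfolding P' cx .
  also have "\<dots> \<le> (\<Sum>a\<le>k. lpp w (pt (1 + int (a * n)) (y a)) (pt (1 + int (a * n) + int n) (y (Suc a))))
      + lpp w (pt ?P x') (pt (?P + int n) x)"
    using y(4) by simp
  also have "\<dots> = (\<Sum>a\<le>Suc k. lpp w (pt (1 + int (a * n)) (y' a)) (pt (1 + int (a * n) + int n) (y' (Suc a))))"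
    unfolding sum.atMost_Suc
  proof (intro arg_cong2[of _ _ _ _ "(+)"] sum.cong refl)
    show "lpp w (pt ?P x') (pt (?P + int n) x)
        = lpp w (pt (1 + int (Suc k * n)) (y' (Suc k))) (pt (1 + int (Suc k * n) + int n) (y' (Suc (Suc k))))"
      using y(2) by (simp add: y'_def)
  qed (simp add: y'a)
  finally have "lpp w (pt 1 0) (pt (1 + int (Suc (Suc k) * n)) x)
      \<le> (\<Sum>a\<le>Suc k. lpp w (pt (1 + int (a * n)) (y' a)) (pt (1 + int (a * n) + int n) (y' (Suc a))))" .
  moreover have "y' 0 = 0" "y' (Suc (Suc k)) = x" using y(1) by (simp_all add: y'_def)
  moreover have "\<forall>a\<le>Suc k. \<bar>y' (Suc a) - y' a\<bar> \<le> int n"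
    using y(2,3) x'(2) by (auto simp: y'_def le_Suc_eq)
  ultimately show ?case by blast
qed

text \<open>The sequence travels from 0 to \<open>J a\<close> and back, so twice
  \<open>|J a|\<close> is at most the total variation.\<close>

lemma excursion_le_variation:
  fixes J :: "nat \<Rightarrow> real"
  assumes "J 0 = 0" "J (Suc k) = 0"
  shows "2 * (\<Sum>a\<le>k. \<bar>J a\<bar>) \<le> (real k + 1) * (\<Sum>a\<le>k. \<bar>J (Suc a) - J a\<bar>)"
proof -
  have tele: "\<bar>J (a + l) - J a\<bar> \<le> (\<Sum>i = a..<a + l. \<bar>J (Suc i) - J i\<bar>)" for a l
    by (induction l) auto
  have "2 * \<bar>J a\<bar> \<le> (\<Sum>a\<le>k. \<bar>J (Suc a) - J a\<bar>)" if "a \<le> k" for a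
  proof -
    have "2 * \<bar>J a\<bar> \<le> (\<Sum>i = 0..<a. \<bar>J (Suc i) - J i\<bar>) + (\<Sum>i = a..<Suc k. \<bar>J (Suc i) - J i\<bar>)"
      using tele[of 0 a] tele[of a "Suc k - a"] that assms by simp
    also have "\<dots> = (\<Sum>i = 0..<Suc k. \<bar>J (Suc i) - J i\<bar>)"
      using that by (intro sum.atLeastLessThan_concat) auto
    finally show ?thesis by (simp only: lessThan_atLeast0[symmetric] lessThan_Suc_atMost)
  qed
  then have "(\<Sum>a\<le>k. 2 * \<bar>J a\<bar>) \<le> (\<Sum>b\<le>k. (\<Sum>a\<le>k. \<bar>J (Suc a) - J a\<bar>))"
    by (intro sum_mono) auto
  then show ?thesis by (simp add: sum_distrib_left algebra_simps)
qed

text \<open>Comparison with the telescoping terms \<open>K * K / (a * (a + 1))\<close> at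
  \<open>a = K + R\<close>; the remainder subtracted in the first claim carries the induction. The
  bound is uniform in \<open>R\<close>, so the number of columns does not enter.\<close>

lemma sum_inverse_square_symmetric:
  fixes K :: real
  assumes "1 \<le> K"
  shows "(\<Sum>j\<in>{- int R..int R}. 1 / (1 + \<bar>real_of_int j\<bar> / K)\<^sup>2) \<le> 1 + 2 * K"
proof -
  have "(\<Sum>j\<in>{- int R..int R}. 1 / (1 + \<bar>real_of_int j\<bar> / K)\<^sup>2) \<le> 1 + 2 * K - 2 * (K * K / (K + real R))"
  proof (induction R)
    case 0
    then show ?case using assms by simp
  next
    case (Suc R)
    let ?f = "\<lambda>j::int. 1 / (1 + \<bar>real_of_int j\<bar> / K)\<^sup>2"
    let ?a = "K + real R"
    have "{- int (Suc R)..int (Suc R)} = insert (int (Suc R)) (insert (- int (Suc R)) {- int R..int R})"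
      by auto
    then have "sum ?f {- int (Suc R)..int (Suc R)} = 2 * ?f (int (Suc R)) + sum ?f {- int R..int R}"
      by (simp add: add.commute)
    also have "?f (int (Suc R)) = K * K / ((?a + 1) * (?a + 1))"
      using assms by (simp add: field_simps power2_eq_square)
    also have "\<dots> \<le> K * K / (?a * (?a + 1))"
      using assms by (intro divide_left_mono mult_right_mono mult_pos_pos) auto
    also have "\<dots> = K * K / ?a - K * K / (?a + 1)"
      using assms by (simp add: field_simps)
    finally show ?case using Suc.IH by (simp add: algebra_simps)
  qed
  also have "\<dots> \<le> 1 + 2 * K" using assms by simp
  finally show ?thesis .
qed

text \<open>The sum over \<open>j'\<close> is at most 3 and the sum over \<open>j\<close> at most
  \<open>1 + 2 * k\<close>: a whole slab costs about as much as \<open>k\<close> blocks.\<close>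

lemma sum_cost_le:
  assumes "1 \<le> k"
  shows "(\<Sum>j\<in>{- int R..int R}. \<Sum>j'\<in>{- int R..int R}.
      1 / ((1 + \<bar>real_of_int (j' - j)\<bar>)\<^sup>2 * (1 + \<bar>real_of_int j\<bar> / real k)\<^sup>2)) \<le> 9 * real k"
proof -
  let ?f = "\<lambda>j::int. 1 / (1 + \<bar>real_of_int j\<bar> / real k)\<^sup>2"
  let ?g = "\<lambda>d::int. 1 / (1 + \<bar>real_of_int d\<bar> / 1)\<^sup>2"
  have inner: "(\<Sum>j'\<in>{- int R..int R}. ?g (j' - j)) \<le> 3" if "j \<in> {- int R..int R}" for j
  proof -
    have "(\<Sum>j'\<in>{- int R..int R}. ?g (j' - j)) = sum ?g ((\<lambda>j'. j' - j) ` {- int R..int R})"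
      by (subst sum.reindex) (auto simp: inj_on_def)
    also have "\<dots> \<le> sum ?g {- int (2 * R)..int (2 * R)}"
      using that by (intro sum_mono2) auto
    also have "\<dots> \<le> 1 + 2 * 1" by (rule sum_inverse_square_symmetric) simp
    finally show ?thesis by simp
  qed
  have "(\<Sum>j\<in>{- int R..int R}. \<Sum>j'\<in>{- int R..int R}.
      1 / ((1 + \<bar>real_of_int (j' - j)\<bar>)\<^sup>2 * (1 + \<bar>real_of_int j\<bar> / real k)\<^sup>2))
    = (\<Sum>j\<in>{- int R..int R}. ?f j * (\<Sum>j'\<in>{- int R..int R}. ?g (j' - j)))"
    by (simp add: sum_distrib_left mult.commute)
  also have "\<dots> \<le> (\<Sum>j\<in>{- int R..int R}. ?f j * 3)"
    by (intro sum_mono mult_left_mono inner) auto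
  also have "\<dots> = 3 * (\<Sum>j\<in>{- int R..int R}. ?f j)" by (simp add: sum_distrib_left mult.commute)
  also have "\<dots> \<le> 3 * (1 + 2 * real k)"
    using assms by (intro mult_left_mono sum_inverse_square_symmetric) auto
  also have "\<dots> \<le> 9 * real k" using assms by simp
  finally show ?thesis .
qed

context lpp_tails
begin

lemma block_le_decreasing:
  assumes "(\<Union>x\<in>col b j. \<Union>y\<in>col b j'. rect (pt p x) (pt (p + int n) y)) \<subseteq> F"
  shows "decreasing_on F (block_le p n b j j' t)"
  unfolding decreasing_on_def block_le_def
proof (intro allI impI ballI)
  fix w w' :: "int \<times> int \<Rightarrow> real" and x y
  assume le: "\<forall>v\<in>F. w v \<le> w' v" and xy: "x \<in> col b j" "y \<in> col b j'" "\<bar>y - x\<bar> \<le> int n"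
    and "\<forall>x\<in>col b j. \<forall>y\<in>col b j'. \<bar>y - x\<bar> \<le> int n \<longrightarrow> lpp w' (pt p x) (pt (p + int n) y) \<le> t"
  then have "lpp w' (pt p x) (pt (p + int n) y) \<le> t" by blast
  moreover have "lpp w (pt p x) (pt (p + int n) y) \<le> lpp w' (pt p x) (pt (p + int n) y)"
    using le xy assms by (intro lpp_mono) (auto simp: dominated_pt)
  ultimately show "lpp w (pt p x) (pt (p + int n) y) \<le> t" by simp
qed

text \<open>The term \<open>- g |j' - j|\<close> pays for the term \<open>2 g |j| / k\<close> along any path that returns to
  column \<open>0\<close>, so the allowance growing with \<open>|j|\<close> is harmless, while it makes the
  blocks far from the diagonal cheap.\<close>

lemma blocks_force_low_passage:
  fixes \<sigma> g :: real
  assumes w: "\<And>v. 0 \<le> w v" and b: "0 < b" and k: "1 \<le> k" and sig: "0 \<le> \<sigma>" and g: "0 \<le> g"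
    and blocks: "\<And>a j j'. a < k \<Longrightarrow> j \<in> {- int (k * n)..int (k * n)} \<Longrightarrow> j' \<in> {- int (k * n)..int (k * n)} \<Longrightarrow>
      block_le (1 + int (a * n)) n b j j' (\<mu> * real n + \<sigma> *
         (- 1/2 - g * \<bar>real_of_int (j' - j)\<bar> + 2 * g * \<bar>real_of_int j\<bar> / real k)) w"
  shows "Xw (1 + k * n) 0 w \<le> \<mu> * real (k * n) - real k / 2 * \<sigma>"
proof -
  obtain k' where k': "k = Suc k'" using k by (cases k) auto
  have "\<exists>y. y 0 = 0 \<and> y k = 0 \<and> (\<forall>a\<le>k'. \<bar>y (Suc a) - y a\<bar> \<le> int n) \<and>
    lpp w (pt 1 0) (pt (1 + int (k * n)) 0)
      \<le> (\<Sum>a\<le>k'. lpp w (pt (1 + int (a * n)) (y a)) (pt (1 + int (a * n) + int n) (y (Suc a))))"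
    unfolding k' by (rule lpp_chain[OF w]) simp
  then obtain y where y: "y 0 = 0" "y k = 0" "\<forall>a\<le>k'. \<bar>y (Suc a) - y a\<bar> \<le> int n"
    "lpp w (pt 1 0) (pt (1 + int (k * n)) 0)
      \<le> (\<Sum>a\<le>k'. lpp w (pt (1 + int (a * n)) (y a)) (pt (1 + int (a * n) + int n) (y (Suc a))))"
    by blast
  define J where "J a = y a div b" for a
  have ybound: "\<bar>y a\<bar> \<le> int (a * n)" if "a \<le> k" for a
    using that
  proof (induction a)
    case 0
    then show ?case using y(1) by simp
  next
    case (Suc a)
    then have "\<bar>y (Suc a) - y a\<bar> \<le> int n" "\<bar>y a\<bar> \<le> int (a * n)" using y(3) k' by auto
    then show ?case by simp
  qed
  \<comment> \<open>A column index is at most the offset itself because \<open>b\<close> is at least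
    1. This crude range is harmless, the bound on the total cost being independent of it.\<close>
  have Jbound: "J a \<in> {- int (k * n)..int (k * n)}" if "a \<le> k" for a
  proof -
    have "a * n \<le> k * n" using that by simp
    then have "\<bar>y a\<bar> \<le> int (k * n)" using ybound[OF that] by linarith
    moreover have "\<bar>J a\<bar> \<le> \<bar>y a\<bar>"
    proof (cases "0 \<le> y a")
      case True
      then have J0: "0 \<le> J a" using b by (simp add: J_def pos_imp_zdiv_nonneg_iff)
      then have "J a * 1 \<le> J a * b" using b by (intro mult_left_mono) auto
      also have "\<dots> \<le> y a" using mem_col_div[OF b, of "y a"] by (simp add: col_def J_def)
      finally show ?thesis using J0 by simp
    next
      case False
      have "y a \<le> y a div b"
      proof (rule ccontr)
        assume "\<not> ?thesis"
        then have "(y a div b + 1) * b \<le> y a * b" using b by (intro mult_right_mono) auto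
        also have "\<dots> \<le> y a * 1" using False b by (intro mult_left_mono_neg) auto
        finally show False using mem_col_div[OF b, of "y a"] by (simp add: col_def)
      qed
      moreover have "y a div b \<le> 0" using False b by (simp add: div_nonpos_pos_le0)
      ultimately show ?thesis by (simp add: J_def)
    qed
    ultimately show ?thesis by auto
  qed
  have seg: "lpp w (pt (1 + int (a * n)) (y a)) (pt (1 + int (a * n) + int n) (y (Suc a)))
      \<le> \<mu> * real n + \<sigma> * (- 1/2 - g * \<bar>real_of_int (J (Suc a)) - real_of_int (J a)\<bar>
          + 2 * g / real k * \<bar>real_of_int (J a)\<bar>)" if "a \<le> k'" for a
  proof -
    have "block_le (1 + int (a * n)) n b (J a) (J (Suc a)) (\<mu> * real n + \<sigma> *
         (- 1/2 - g * \<bar>real_of_int (J (Suc a) - J a)\<bar> + 2 * g * \<bar>real_of_int (J a)\<bar> / real k)) w"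
      using that k' by (intro blocks Jbound) auto
    moreover have "y a \<in> col b (J a)" "y (Suc a) \<in> col b (J (Suc a))"
      unfolding J_def by (rule mem_col_div[OF b])+
    moreover have "\<bar>y (Suc a) - y a\<bar> \<le> int n" using y(3) that by blast
    ultimately show ?thesis unfolding block_le_def by auto
  qed
  define V where "V = (\<Sum>a\<le>k'. \<bar>real_of_int (J (Suc a)) - real_of_int (J a)\<bar>)"
  define W where "W = (\<Sum>a\<le>k'. \<bar>real_of_int (J a)\<bar>)"
  have "2 * W \<le> (real k' + 1) * V"
    unfolding V_def W_def
    using y(1,2) k' by (intro excursion_le_variation) (auto simp: J_def)
  \<comment> \<open>The allowance collected along the path, \<open>2 * g * W / k\<close>, is at most
    the penalty \<open>g * V\<close>.\<close>
  then have "2 * W / real k \<le> V" using k' by (simp add: divide_le_eq algebra_simps)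
  then have VW: "g * (2 * W / real k) \<le> g * V" using g by (rule mult_left_mono)
  have "Xw (1 + k * n) 0 w = lpp w (pt 1 0) (pt (1 + int (k * n)) 0)"
    by (simp add: Xw_def pt_def)
  also have "\<dots> \<le> (\<Sum>a\<le>k'. \<mu> * real n + \<sigma> * (- 1/2 - g * \<bar>real_of_int (J (Suc a)) - real_of_int (J a)\<bar>
          + 2 * g / real k * \<bar>real_of_int (J a)\<bar>))"
    using y(4) by (rule order.trans) (intro sum_mono seg, simp)
  also have "\<dots> = \<mu> * real (k * n) + \<sigma> * (- real k / 2 - g * V + 2 * g / real k * W)"
  proof -
    have lin: "(\<Sum>a\<le>K. c + \<sigma> * (- 1/2 - g * v a + q * u a))
        = (real K + 1) * c + \<sigma> * (- (real K + 1) / 2 - g * sum v {..K} + q * sum u {..K})"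
      for K c q and v u :: "nat \<Rightarrow> real"
      by (induction K) (simp_all add: field_simps)
    have "(real k' + 1) * (\<mu> * real n) = \<mu> * real (k * n)" "real k' + 1 = real k"
      by (simp_all add: k' algebra_simps)
    then show ?thesis unfolding lin V_def W_def by simp
  qed
  also have "\<dots> \<le> \<mu> * real (k * n) + \<sigma> * (- real k / 2)"
    using VW sig by (intro add_left_mono mult_left_mono) (auto simp: algebra_simps)
  finally show ?thesis by (simp add: mult.commute)
qed

text \<open>\<open>k\<close> slabs at cost at most \<open>9 * A * k\<close> each produce the square
  of \<open>k\<close> in the exponent.\<close>

lemma low_passage_cost:
  "\<exists>m::nat. 1 \<le> m \<and> (\<exists>A>0. \<exists>s0>1. \<forall>s k::nat. real s > s0 \<and> 1 \<le> k \<longrightarrow>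
     exp (- (A * (real k)\<^sup>2)) \<le> pr (\<lambda>w. Xw (1 + k * (m * s)) 0 w
        \<le> \<mu> * real (k * (m * s)) - real k / 2 * real s powr (1/3)))"
proof -
  obtain m g A s0 where m: "1 \<le> m" and g: "g > 0" and A: "A > 0" and s0: "s0 > 1" and cost:
    "\<forall>s k::nat. \<forall>p j j'. real s > s0 \<and> 1 \<le> k \<longrightarrow>
     exp (- (A / ((1 + \<bar>real_of_int (j' - j)\<bar>)\<^sup>2 * (1 + \<bar>real_of_int j\<bar> / real k)\<^sup>2)))
     \<le> pr (block_le p (m * s) (block_width s) j j' (\<mu> * real (m * s) + real s powr (1/3) *
         (- 1/2 - g * \<bar>real_of_int (j' - j)\<bar> + 2 * g * \<bar>real_of_int j\<bar> / real k)))"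
    using block_cost by (elim exE conjE) (rule that)
  have main: "exp (- (9 * A * (real k)\<^sup>2)) \<le> pr (\<lambda>w. Xw (1 + k * (m * s)) 0 w
        \<le> \<mu> * real (k * (m * s)) - real k / 2 * real s powr (1/3))"
    if s: "real s > s0" and k: "1 \<le> k" for s k :: nat
  proof -
    define n where "n = m * s"
    define b where "b = block_width s"
    define \<sigma> where "\<sigma> = real s powr (1/3)"
    define I where "I = {- int (k * n)..int (k * n)}"
    define T where "T = {..<k} \<times> I \<times> I"
    define Y where "Y j j' = (1 + \<bar>real_of_int (j' - j)\<bar>)\<^sup>2 * (1 + \<bar>real_of_int j\<bar> / real k)\<^sup>2"
      for j j' :: int
    define Q where "Q e = (case e of (a, j, j') \<Rightarrow> block_le (1 + int (a * n)) n b j j' (\<mu> * real n + \<sigma> *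
         (- 1/2 - g * \<bar>real_of_int (j' - j)\<bar> + 2 * g * \<bar>real_of_int j\<bar> / real k)))"
      for e :: "nat \<times> int \<times> int"
    \<comment> \<open>One finite set of sites carrying all block events, as association on a finite
      product requires.\<close>
    define F where "F = (\<Union>(a, j, j')\<in>T. \<Union>x\<in>col b j. \<Union>y\<in>col b j'.
       rect (pt (1 + int (a * n)) x) (pt (1 + int (a * n) + int n) y))"
    have finT: "finite T" by (simp add: T_def I_def)
    have finF: "finite F" unfolding F_def using finT by (auto simp: col_def)
    have b: "0 < b" using block_width_bounds(1)[of s] s s0 by (simp add: b_def)
    have "(\<Sum>e\<in>T. A / Y (fst (snd e)) (snd (snd e))) = (\<Sum>a<k. \<Sum>j\<in>I. \<Sum>j'\<in>I. A / Y j j')"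
      unfolding T_def sum.cartesian_product by (intro sum.cong) auto
    also have "\<dots> = real k * (A * (\<Sum>j\<in>I. \<Sum>j'\<in>I. 1 / Y j j'))"
      by (simp add: sum_distrib_left)
    also have "\<dots> \<le> real k * (A * (9 * real k))"
      unfolding I_def Y_def using A k by (intro mult_left_mono sum_cost_le) auto
    finally have total: "(\<Sum>e\<in>T. A / Y (fst (snd e)) (snd (snd e))) \<le> 9 * A * (real k)\<^sup>2"
      by (simp add: power2_eq_square mult_ac)
    have "exp (- (9 * A * (real k)\<^sup>2)) \<le> exp (\<Sum>e\<in>T. - (A / Y (fst (snd e)) (snd (snd e))))"
      using total by (simp add: sum_negf)
    also have "\<dots> = (\<Prod>e\<in>T. exp (- (A / Y (fst (snd e)) (snd (snd e)))))"
      using finT by (rule exp_sum)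
    also have "\<dots> \<le> (\<Prod>e\<in>T. pr (Q e))"
    proof (rule prod_mono, intro conjI)
      fix e assume "e \<in> T"
      obtain a j j' where e: "e = (a, j, j')" by (cases e)
      show "exp (- (A / Y (fst (snd e)) (snd (snd e)))) \<le> pr (Q e)"
        using cost[rule_format, of s k j' j "1 + int (a * n)"] s k
        by (simp add: e Q_def Y_def n_def b_def \<sigma>_def)
    qed simp
    also have "\<dots> \<le> pr (\<lambda>w. \<forall>e\<in>T. Q e w)"
    proof (rule harris_finite[OF finT finF])
      fix e assume e: "e \<in> T"
      obtain a j j' where e': "e = (a, j, j')" by (cases e)
      show "decreasing_on F (Q e)"
        unfolding e' Q_def prod.case
        by (rule block_le_decreasing) (use e e' in \<open>auto simp: F_def\<close>)
      show "Measurable.pred env (Q e)" unfolding e' Q_def prod.case by measurable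
    qed
    also have "\<dots> \<le> pr (\<lambda>w. Xw (1 + k * n) 0 w \<le> \<mu> * real (k * n) - real k / 2 * \<sigma>)"
    proof (rule pr_mono_nonneg)
      fix w :: "int \<times> int \<Rightarrow> real" assume w: "\<And>v. 0 \<le> w v" and Q: "\<forall>e\<in>T. Q e w"
      show "Xw (1 + k * n) 0 w \<le> \<mu> * real (k * n) - real k / 2 * \<sigma>"
      proof (rule blocks_force_low_passage[OF w b k, where g = g])
        show "0 \<le> \<sigma>" "0 \<le> g" using g by (simp_all add: \<sigma>_def)
        fix a j j' assume "a < k" "j \<in> {- int (k * n)..int (k * n)}" "j' \<in> {- int (k * n)..int (k * n)}"
        then have "(a, j, j') \<in> T" by (simp add: T_def I_def)
        with Q show "block_le (1 + int (a * n)) n b j j' (\<mu> * real n + \<sigma> *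
            (- 1/2 - g * \<bar>real_of_int (j' - j)\<bar> + 2 * g * \<bar>real_of_int j\<bar> / real k)) w"
          by (auto simp: Q_def)
      qed
    qed measurable
    finally show ?thesis by (simp only: n_def \<sigma>_def)
  qed
  have A9: "9 * A > 0" using A by simp
  show ?thesis
    by (rule exI[of _ m], rule conjI[OF m], rule exI[of _ "9 * A"], rule conjI[OF A9],
        rule exI[of _ s0], rule conjI[OF s0]) (intro allI impI main; simp)
qed

end

section \<open>The lower tail\<close>

context lpp_tails
begin

text \<open>This allows rounding \<open>r\<close> up to a multiple of the slab height: a low value
  at the larger index forces one at \<open>r\<close>.\<close>

lemma Xw_diagonal_mono:
  assumes w: "\<And>v. 0 \<le> w v" and "1 \<le> r" "r < N"
  shows "Xw r 0 w \<le> Xw N 0 w"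
proof -
  have "lpp w (pt 1 0) (pt (int r) 0) + lpp w (pt (int r + 1) 0) (pt (int N) 0) \<le> lpp w (pt 1 0) (pt (int N) 0)"
    using lpp_superadditive[of w "pt 1 0" "pt (int r) 0" "pt (int N) 0"] w assms(2,3)
    by (simp add: pt_add_one dominated_pt)
  moreover have "0 \<le> lpp w (pt (int r + 1) 0) (pt (int N) 0)"
  proof -
    have "dominated (pt (int r + 1) 0) (pt (int N) 0)" using assms by (simp add: dominated_pt)
    then obtain \<gamma> where "lpp w (pt (int r + 1) 0) (pt (int N) 0) = path_weight w \<gamma>"
      by (rule lpp_attained)
    then show ?thesis using w by (auto simp: path_weight_def intro!: sum_list_nonneg)
  qed
  ultimately show ?thesis by (simp add: Xw_def pt_def)
qed

theorem lower_tail_lower_bound: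
  "\<exists>c>0. \<exists>\<eta>>0. \<exists>\<theta>0::real. \<exists>r0::real. \<forall>r::nat. \<forall>\<theta>::real.
      real r > r0 \<and> \<theta>0 < \<theta> \<and> \<theta> < \<eta> * real r powr (2/3) \<longrightarrow>
      exp (- c * \<theta> ^ 3) \<le> pr (\<lambda>w. Xw r 0 w - mX r 0 \<le> - \<theta> * real r powr (1/3))"
proof -
  obtain m A s0 where m: "1 \<le> m" and A: "A > 0" and s0: "s0 > 1" and cost:
    "\<forall>s k::nat. real s > s0 \<and> 1 \<le> k \<longrightarrow>
     exp (- (A * (real k)\<^sup>2)) \<le> pr (\<lambda>w. Xw (1 + k * (m * s)) 0 w
        \<le> \<mu> * real (k * (m * s)) - real k / 2 * real s powr (1/3))"
    using low_passage_cost by (elim exE conjE) (rule that)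
  from LS obtain \<rho> G H g1 g2 r1 where ls: "\<rho> > 0" "g1 > 0"
    "\<forall>r::nat. real r > r1 \<longrightarrow> (\<forall>z::int. \<bar>real_of_int z\<bar> \<le> \<rho> * real r \<longrightarrow>
      \<mu> * real r - G * real_of_int z ^ 2 / real r - H * real_of_int z ^ 4 / real r ^ 3
        - g1 * real r powr (1/3) \<le> mX r z \<and>
      mX r z \<le> \<mu> * real r - G * real_of_int z ^ 2 / real r - g2 * real r powr (1/3))"
    by blast
  define M where "M = real m"
  have M: "M \<ge> 1" using m by (simp add: M_def)
  \<comment> \<open>Ensures \<open>8 * M \<le> b^2\<close>, so that
    \<open>b^2 * \<theta> / (4 * M)\<close>, which remains when half the gain is spent on rounding,
    is at least \<open>2 * \<theta>\<close>.\<close>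
  define b where "b = 8 * M"
  have b: "b \<ge> 1" using M by (simp add: b_def)
  \<comment> \<open>\<open>e\<close> will bound the cube root of \<open>k / r\<close>. The second
    entry keeps the rounding error below half the gain, the third keeps \<open>r / (k * M)\<close>
    above \<open>s0\<close>.\<close>
  define e where "e = min 1 (min (1 / (4 * M * M * (\<bar>\<mu>\<bar> + 1))) (1 / (M * s0 + 1)))"
  have Ms: "M * s0 > 0" using M s0 by simp
  have e0: "e > 0" and e1: "e \<le> 1" using M Ms by (auto simp: e_def)
  have emu: "\<bar>\<mu>\<bar> * M * e \<le> 1 / (4 * M)"
  proof -
    have "\<bar>\<mu>\<bar> * M * e \<le> (\<bar>\<mu>\<bar> + 1) * M * (1 / (4 * M * M * (\<bar>\<mu>\<bar> + 1)))"
      using M e0 by (intro mult_mono) (auto simp: e_def)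
    also have "\<dots> = 1 / (4 * M)"
    proof -
      have "n * M * (1 / (4 * M * M * n)) = 1 / (4 * M)" if "n > 0" for n
        using M that by (simp add: field_simps)
      then show ?thesis by simp
    qed
    finally show ?thesis .
  qed
  have es: "e ^ 3 * (M * s0) < 1"
  proof -
    have "e ^ 3 \<le> e ^ 1" using e0 e1 by (intro power_decreasing) auto
    also have "e ^ 1 \<le> 1 / (M * s0 + 1)" by (simp add: e_def)
    finally have "e ^ 3 * (M * s0) \<le> 1 / (M * s0 + 1) * (M * s0)" using Ms by (intro mult_right_mono) auto
    also have "\<dots> < 1" using Ms by simp
    finally show ?thesis .
  qed
  \<comment> \<open>Taking square roots, the upper limit on \<theta> becomes
    \<open>2 * b * sqrt \<theta> < e * u\<close>, with \<open>u\<close> the cube root of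
    \<open>r\<close>.\<close>
  define \<eta> where "\<eta> = (e / (2 * b))\<^sup>2"
  \<comment> \<open>From \<open>A * k^2\<close> with \<open>k\<close> at most
    \<open>2 * (b * v) ^ 3\<close> and \<open>v\<close> the square root of \<theta>.\<close>
  define c where "c = 4 * A * b ^ 6"
  have main: "exp (- c * \<theta> ^ 3) \<le> pr (\<lambda>w. Xw r 0 w - mX r 0 \<le> - \<theta> * real r powr (1/3))"
    if r: "real r > max 0 r1" and th: "\<theta> > max 1 g1" and th_eta: "\<theta> < \<eta> * real r powr (2/3)"
    for r :: nat and \<theta> :: real
  proof -
    define u where "u = real r powr (1/3)"
    have u3: "real r = u ^ 3" by (simp add: u_def powr_third_cubed)
    have u0: "u > 0" using r by (simp add: u_def)
    have u2: "real r powr (2/3) = u\<^sup>2" using r by (simp add: u_def powr_power)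
    define v where "v = sqrt \<theta>"
    have v2: "v\<^sup>2 = \<theta>" and v1: "v \<ge> 1" using th by (auto simp: v_def)
    have "v\<^sup>2 < (e / (2 * b) * u)\<^sup>2" using th_eta unfolding v2 u2 \<eta>_def power_mult_distrib .
    then have "v < e / (2 * b) * u" by (rule power2_less_imp_less) (use e0 b u0 in auto)
    then have vu: "2 * b * v \<le> e * u" using b by (simp add: field_simps)
    define k where "k = nat \<lceil>(b * v) ^ 3\<rceil>"
    have bv: "1 \<le> b * v" using b v1 mult_mono[of 1 b 1 v] by simp
    have bv3: "1 \<le> (b * v) ^ 3" using bv by simp
    have k_lo: "(b * v) ^ 3 \<le> real k" unfolding k_def by linarith
    have k_hi: "real k \<le> 2 * (b * v) ^ 3" using bv3 unfolding k_def by linarith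
    have k1: "1 \<le> k" using k_lo bv3 by linarith
    define q where "q = real k powr (1/3)"
    have q3: "real k = q ^ 3" by (simp add: q_def powr_third_cubed)
    have q0: "q > 0" using k1 by (simp add: q_def)
    have q_lo: "b * v \<le> q"
      using k_lo q0 bv power_mono_iff[of "b * v" q 3] by (simp add: q3)
    have q_hi: "q \<le> e * u"
    proof -
      have "q ^ 3 \<le> (2 * (b * v)) ^ 3"
        using k_hi bv3 unfolding q3[symmetric] by (simp add: power_mult_distrib)
      then have "q \<le> 2 * (b * v)"
        using q0 bv power_mono_iff[of q "2 * (b * v)" 3] by simp
      then show ?thesis using vu by simp
    qed
    \<comment> \<open>Rounding up makes \<open>k * m * s\<close> at least \<open>r\<close>, with an
      excess of at most \<open>k * M\<close> that shifts the centring by at most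
      \<open>\<bar>\<mu>\<bar> * k * M\<close>.\<close>
    define s where "s = nat \<lceil>real r / (real k * M)\<rceil>"
    have kM: "real k * M > 0" using k1 M by simp
    have s_lo: "real r / (real k * M) \<le> real s" unfolding s_def by linarith
    have s_hi: "real s \<le> real r / (real k * M) + 1"
      using kM unfolding s_def by (simp add: ceiling_correct)
    have kms: "real r \<le> real (k * (m * s))"
      using s_lo kM by (simp add: divide_le_eq M_def mult_ac)
    have kms': "real (k * (m * s)) \<le> real r + real k * M"
    proof -
      have "real (k * (m * s)) = real k * M * real s" by (simp add: M_def)
      also have "\<dots> \<le> real k * M * (real r / (real k * M) + 1)"
        using s_hi kM by (intro mult_left_mono) auto
      also have "\<dots> = real r + real k * M"
      proof -
        have "x * (y / x + 1) = y + x" if "x > 0" for x y :: real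
          using that by (simp add: distrib_left)
        then show ?thesis using kM by blast
      qed
      finally show ?thesis .
    qed
    have ss0: "real s > s0"
    proof -
      have "real k * M * s0 = q ^ 3 * (M * s0)" by (simp add: q3)
      also have "\<dots> \<le> (e * u) ^ 3 * (M * s0)"
        using q_hi q0 Ms by (intro mult_right_mono power_mono) auto
      also have "\<dots> = e ^ 3 * (M * s0) * u ^ 3" by (simp add: power_mult_distrib)
      also have "\<dots> < 1 * u ^ 3" using es u0 by (intro mult_strict_right_mono) auto
      finally have "s0 < real r / (real k * M)" using kM by (simp add: u3 less_divide_eq mult_ac)
      then show ?thesis using s_lo by linarith
    qed
    define \<sigma> where "\<sigma> = real s powr (1/3)"
    have sig: "u / (q * M) \<le> \<sigma>"
    proof -
      have "(u / (q * M)) ^ 3 \<le> real r / (real k * M)"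
      proof -
        have "M ^ 1 \<le> M ^ 3" using M by (intro power_increasing) auto
        then have "u ^ 3 / (q ^ 3 * M ^ 3) \<le> u ^ 3 / (q ^ 3 * M)"
          using u0 q0 M by (intro divide_left_mono mult_left_mono mult_pos_pos) auto
        then show ?thesis by (simp add: u3 q3 power_divide power_mult_distrib)
      qed
      also have "\<dots> \<le> \<sigma> ^ 3" using s_lo by (simp add: \<sigma>_def powr_third_cubed)
      finally show ?thesis
        using u0 q0 M power_mono_iff[of "u / (q * M)" \<sigma> 3] by (simp add: \<sigma>_def)
    qed
    \<comment> \<open>The factor 2 leaves one \<open>\<theta> * u\<close> to absorb the
      \<open>g1 * u\<close> by which the mean may lie below \<open>\<mu> * r\<close>.\<close>
    have gain: "\<bar>\<mu>\<bar> * (real k * M) - real k / 2 * \<sigma> \<le> - (2 * \<theta> * u)"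
    proof -
      have "\<bar>\<mu>\<bar> * (real k * M) = q\<^sup>2 * (\<bar>\<mu>\<bar> * M * q)"
        by (simp add: q3 power2_eq_square power3_eq_cube)
      also have "\<dots> \<le> q\<^sup>2 * (\<bar>\<mu>\<bar> * M * (e * u))"
        using q_hi M by (intro mult_left_mono) auto
      also have "\<dots> = q\<^sup>2 * (\<bar>\<mu>\<bar> * M * e * u)" by simp
      also have "\<dots> \<le> q\<^sup>2 * (1 / (4 * M) * u)"
        using emu u0 by (intro mult_left_mono mult_right_mono) auto
      finally have 1: "\<bar>\<mu>\<bar> * (real k * M) \<le> q\<^sup>2 * u / (4 * M)" by simp
      have "real k / 2 * (u / (q * M)) \<le> real k / 2 * \<sigma>" using sig by (intro mult_left_mono) auto
      then have 2: "q\<^sup>2 * u / (2 * M) \<le> real k / 2 * \<sigma>"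
        using q0 M by (simp add: q3 field_simps power2_eq_square power3_eq_cube)
      have "8 * M * \<theta> \<le> b\<^sup>2 * v\<^sup>2"
      proof -
        have "8 * M * 1 \<le> b * b" using M unfolding b_def by (intro mult_mono) auto
        then have "8 * M * \<theta> \<le> b * b * \<theta>" using th by (intro mult_right_mono) auto
        then show ?thesis by (simp add: v2 power2_eq_square[of b])
      qed
      also have "\<dots> \<le> q\<^sup>2"
        using q_lo bv power_mono[of "b * v" q 2] by (simp add: power_mult_distrib)
      finally have "8 * M * \<theta> * u \<le> q\<^sup>2 * u" using u0 by (intro mult_right_mono) auto
      then have "8 * M * \<theta> * u / (4 * M) \<le> q\<^sup>2 * u / (4 * M)" using M by (intro divide_right_mono) auto
      moreover have "8 * M * \<theta> * u / (4 * M) = 2 * \<theta> * u" using M by simp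
      moreover have "q\<^sup>2 * u / (2 * M) = 2 * (q\<^sup>2 * u / (4 * M))" by simp
      ultimately show ?thesis using 1 2 by linarith
    qed
    have mX: "\<mu> * real r - g1 * u \<le> mX r 0"
      using conjunct1[OF ls(3)[rule_format, of r 0]] r ls(1) by (simp add: u_def)
    have final: "\<mu> * real (k * (m * s)) - real k / 2 * \<sigma> \<le> mX r 0 - \<theta> * u"
    proof -
      have "\<mu> * (real (k * (m * s)) - real r) \<le> \<bar>\<mu>\<bar> * (real (k * (m * s)) - real r)"
        using kms by (intro mult_right_mono) auto
      also have "\<dots> \<le> \<bar>\<mu>\<bar> * (real k * M)" using kms' by (intro mult_left_mono) auto
      finally have "\<mu> * real (k * (m * s)) \<le> \<mu> * real r + \<bar>\<mu>\<bar> * (real k * M)"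
        by (simp add: right_diff_distrib)
      moreover have "g1 * u \<le> \<theta> * u" using th u0 by (intro mult_right_mono) auto
      ultimately show ?thesis using gain mX by linarith
    qed
    have "c * \<theta> ^ 3 = A * (2 * (b * v) ^ 3)\<^sup>2"
      by (simp add: c_def v2[symmetric] power_mult_distrib flip: power_mult)
    moreover have "A * (real k)\<^sup>2 \<le> A * (2 * (b * v) ^ 3)\<^sup>2"
      using k_hi A by (intro mult_left_mono power_mono) auto
    ultimately have "exp (- c * \<theta> ^ 3) \<le> exp (- (A * (real k)\<^sup>2))" by simp
    also have "\<dots> \<le> pr (\<lambda>w. Xw (1 + k * (m * s)) 0 w \<le> \<mu> * real (k * (m * s)) - real k / 2 * \<sigma>)"
      unfolding \<sigma>_def using ss0 k1 by (intro cost[rule_format] conjI)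
    also have "\<dots> \<le> pr (\<lambda>w. Xw r 0 w - mX r 0 \<le> - \<theta> * u)"
    proof (rule pr_mono_nonneg)
      fix w :: "int \<times> int \<Rightarrow> real" assume w: "\<And>v. 0 \<le> w v"
        and X: "Xw (1 + k * (m * s)) 0 w \<le> \<mu> * real (k * (m * s)) - real k / 2 * \<sigma>"
      have "r \<le> k * (m * s)" using kms by linarith
      then have "Xw r 0 w \<le> Xw (1 + k * (m * s)) 0 w"
        using r by (intro Xw_diagonal_mono w) auto
      then show "Xw r 0 w - mX r 0 \<le> - \<theta> * u" using X final by simp
    qed measurable
    finally show ?thesis by (simp only: u_def)
  qed
  have c0: "c > 0" using A b by (simp add: c_def)
  have eta0: "\<eta> > 0" using e0 b by (simp add: \<eta>_def)
  show ?thesis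
    by (rule exI[of _ c], rule conjI[OF c0], rule exI[of _ \<eta>], rule conjI[OF eta0],
        rule exI[of _ "max 1 g1"], rule exI[of _ "max 0 r1"]) (intro allI impI main; simp)
qed

end

section \<open>Transfer from the random field to the product environment\<close>

theorem theorem4:
  fixes M :: "'a measure" and \<xi> :: "int \<times> int \<Rightarrow> 'a \<Rightarrow> real"
    and \<mu> :: real and \<alpha> :: real
  assumes P: "prob_space M"
    and rv: "\<And>v. \<xi> v \<in> borel_measurable M"
    and indep: "prob_space.indep_vars M (\<lambda>_. borel) \<xi> UNIV"
    and ident: "\<And>v. distr M borel (\<xi> v) = distr M borel (\<xi> (0, 0))"
    and nonneg: "\<And>v. AE \<omega> in M. 0 \<le> \<xi> v \<omega>"
    and integ: "\<And>v. integrable M (\<xi> v)"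
    and mu: "(\<lambda>r::nat. prob_space.expectation M (Xrz \<xi> r 0) / real r) \<longlonglongrightarrow> \<mu>"
    and LS: "\<exists>\<rho>>0. \<exists>G>0. \<exists>H>0. \<exists>g1>0. \<exists>g2>0. \<exists>r0::real. \<forall>r::nat. real r > r0 \<longrightarrow>
        (\<forall>z::int. \<bar>real_of_int z\<bar> \<le> \<rho> * real r \<longrightarrow>
          \<mu> * real r - G * real_of_int z ^ 2 / real r - H * real_of_int z ^ 4 / real r ^ 3
              - g1 * real r powr (1/3)
            \<le> prob_space.expectation M (Xrz \<xi> r z) \<and>
          prob_space.expectation M (Xrz \<xi> r z)
            \<le> \<mu> * real r - G * real_of_int z ^ 2 / real r - g2 * real r powr (1/3))"
    and alpha_pos: "\<alpha> > 0"
    and UT: "\<forall>\<epsilon>>0. \<exists>c>0. \<exists>\<theta>0>0. \<exists>r0>0. \<forall>r::nat. \<forall>\<theta>::real. \<forall>z::int.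
        real r > r0 \<and> \<theta> > \<theta>0 \<and> \<bar>real_of_int z\<bar> \<le> (1 - \<epsilon>) * real r \<longrightarrow>
        prob_space.prob M {\<omega> \<in> space M. Xrz \<xi> r z \<omega> - prob_space.expectation M (Xrz \<xi> r z)
            > \<theta> * real r powr (1/3)} \<le> exp (- c * \<theta> powr \<alpha>)"
    and LT: "\<forall>\<epsilon>>0. \<exists>c>0. \<exists>\<theta>0>0. \<exists>r0>0. \<forall>r::nat. \<forall>\<theta>::real. \<forall>z::int.
        real r > r0 \<and> \<theta> > \<theta>0 \<and> \<bar>real_of_int z\<bar> \<le> (1 - \<epsilon>) * real r \<longrightarrow>
        prob_space.prob M {\<omega> \<in> space M. Xrz \<xi> r z \<omega> - prob_space.expectation M (Xrz \<xi> r z)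
            < - \<theta> * real r powr (1/3)} \<le> exp (- c * \<theta> powr \<alpha>)"
    and LB: "\<exists>\<delta>>0. \<exists>C>0. \<exists>r0::real. \<forall>r::nat. real r > r0 \<longrightarrow>
        prob_space.prob M {\<omega> \<in> space M. Xrz \<xi> r 0 \<omega> - \<mu> * real r < - C * real r powr (1/3)} \<ge> \<delta>"
  shows "\<exists>c>0. \<exists>\<eta>>0. \<exists>\<theta>0::real. \<exists>r0::real. \<forall>r::nat. \<forall>\<theta>::real.
      real r > r0 \<and> \<theta>0 < \<theta> \<and> \<theta> < \<eta> * real r powr (2/3) \<longrightarrow>
      prob_space.prob M {\<omega> \<in> space M. Xrz \<xi> r 0 \<omega> - prob_space.expectation M (Xrz \<xi> r 0)
          \<le> - \<theta> * real r powr (1/3)} \<ge> exp (- c * \<theta> ^ 3)"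
proof -
  interpret M: prob_space M by fact
  define \<nu> where "\<nu> = distr M borel (\<xi> (0, 0))"
  interpret iid_field \<nu>
  proof -
    interpret prob_space \<nu> unfolding \<nu>_def by (intro M.prob_space_distr rv)
    show "iid_field \<nu>"
    proof
      show "sets \<nu> = sets borel" by (simp add: \<nu>_def)
      show "AE x in \<nu>. 0 \<le> x"
        unfolding \<nu>_def using nonneg rv by (subst AE_distr_iff) auto
    qed
  qed
  let ?X = "\<lambda>\<omega> v. \<xi> v \<omega>"
  \<comment> \<open>Independence and identical marginals say that the field has the product law, so
    probabilities of passage events can be computed in \<open>env\<close>.\<close>
  have law: "distr M (PiM UNIV (\<lambda>_. borel)) ?X = env"
  proof -
    have "distr M (PiM UNIV (\<lambda>_. borel)) (\<lambda>\<omega>. \<lambda>v\<in>UNIV. \<xi> v \<omega>) = PiM UNIV (\<lambda>v. distr M borel (\<xi> v))"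
      using indep rv by (subst (asm) M.indep_vars_iff_distr_eq_PiM) auto
    moreover have "(\<lambda>v. distr M borel (\<xi> v)) = (\<lambda>_. \<nu>)"
      unfolding \<nu>_def by (rule ext) (rule ident)
    ultimately show ?thesis by (simp add: env_def restrict_def)
  qed
  have transfer: "M.prob {\<omega> \<in> space M. Q (?X \<omega>)} = pr Q" if "Measurable.pred env Q" for Q
  proof -
    have S: "{w. Q w} \<in> sets (PiM UNIV (\<lambda>_. borel))"
      using pred_sets[OF that] sets_distr[of M "PiM UNIV (\<lambda>_. borel)" ?X] unfolding law by simp
    have meas: "?X \<in> measurable M (PiM UNIV (\<lambda>_. borel))"
      by (rule measurable_PiM_single') (use rv in \<open>auto simp: space_PiM\<close>)
    have "pr Q = measure (distr M (PiM UNIV (\<lambda>_. borel)) ?X) {w. Q w}" by (simp add: law pr_def)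
    also have "\<dots> = M.prob {\<omega> \<in> space M. Q (?X \<omega>)}"
      by (subst measure_distr[OF meas S]) (auto intro!: arg_cong[of _ _ M.prob])
    finally show ?thesis by simp
  qed
  have Xm: "(\<lambda>w. Xw n z w) \<in> borel_measurable env" for n z
    unfolding Xw_def[abs_def] by measurable
  have Xrz: "Xrz \<xi> r z \<omega> = Xw r z (?X \<omega>)" for r z \<omega>
    by (simp add: Xrz_def Xw_def)
  have tr_gt: "M.prob {\<omega> \<in> space M. Xrz \<xi> r z \<omega> - a > t} = pr (\<lambda>w. Xw r z w - a > t)" for r z a t
    unfolding Xrz by (rule transfer) (use Xm in measurable)
  have tr_lt: "M.prob {\<omega> \<in> space M. Xrz \<xi> r z \<omega> - a < t} = pr (\<lambda>w. Xw r z w - a < t)" for r z a t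
    unfolding Xrz by (rule transfer) (use Xm in measurable)
  have tr_le: "M.prob {\<omega> \<in> space M. Xrz \<xi> r z \<omega> - a \<le> t} = pr (\<lambda>w. Xw r z w - a \<le> t)" for r z a t
    unfolding Xrz by (rule transfer) (use Xm in measurable)
  \<comment> \<open>With \<open>mX\<close> the expectation over the original space, (LS) carries
    over verbatim; the other assumptions are rewritten by the transfer equations.\<close>
  interpret lpp_tails \<nu> \<mu> \<alpha> "\<lambda>r z. M.expectation (Xrz \<xi> r z)"
    by unfold_locales
      (fact LS, fact alpha_pos, fact UT[unfolded tr_gt], fact LT[unfolded tr_lt], fact LB[unfolded tr_lt])
  show ?thesis
    unfolding tr_le by (rule lower_tail_lower_bound)
qed

end
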